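(* Let $G$ be a generalized H-type Carnot group of rank $k$ and dimension $n$, with identity $e$. The abnormal curves of $G$ starting from $e$ are exactly the Lipschitz curves $\gamma_u:[0,1]\to G$, $\gamma_u(0)=e$, with control $u\in L^\infty([0,1],\mathbb R^k)$ such that $u(t)\in\ker S$ (for a.e. $t\in[0,1]$). The curve $\gamma_u$ is an abnormal geodesic if and only if it is a normal geodesic with initial covector $\lambda=(u,v)$ with $u\in\ker S$, i.e. it is of the form $$\exp_e(tu,tv)=(tu,0),\qquad\forall v\in\mathbb R^{n-k}.$$
   Context: **Generalized H-type Carnot groups.** A step 2 Carnot group of rank $k$ and dimension $n$ is a connected, simply connected Lie group $G$ of dimension $n$ whose Lie algebra splits as $\mathfrak g=\mathfrak g_1\oplus\mathfrak g_2$ with $\dim\mathfrak g_1=k$, $\dim\mathfrak g_2=n-k\ge 1$, $[\mathfrak g_1,\mathfrak g_1]=\mathfrak g_2$, $[\mathfrak g_1,\mathfrak g_2]=[\mathfrak g_2,\mathfrak g_2]=0$, with a fixed scalar product $g$ on $\mathfrak g$ such that $\mathfrak g_1\perp\mathfrak g_2$. For $V\in\mathfrak g_2$, $J_V:\mathfrak g_1\to\mathfrak g_1$ is the skew-symmetric operator with $g(X,J_VY)=g(V,[X,Y])$ for all $X,Y\in\mathfrak g_1$. The group is of generalized H-type if there is a symmetric, non-zero, non-negative operator $S:\mathfrak g_1\to\mathfrak g_1$ with $J_VJ_W+J_WJ_V=-2g(V,W)S^2$ for all $V,W\in\mathfrak g_2$. The sub-Riemannian structure is the left-invariant distribution generated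 by $\mathfrak g_1$ with the left-invariant metric induced by $g|_{\mathfrak g_1}$. **Coordinates.** Fix orthonormal bases $e_1,\dots,e_k$ of $\mathfrak g_1$ (chosen so that $S$ is diagonal) and $f_1,\dots,f_{n-k}$ of $\mathfrak g_2$. A point $p\in G$ has coordinates $(x,z)\in\mathbb R^k\times\mathbb R^{n-k}$ iff $p=\mathrm{exp}_G(\sum_i x_ie_i+\sum_\alpha z_\alpha f_\alpha)$, with $\mathrm{exp}_G$ the group exponential; $e=(0,0)$. With $[e_i,e_j]=\sum_\alpha L^\alpha_{ij}f_\alpha$, a global orthonormal frame of the distribution is $X_i=\partial_{x_i}-\frac12\sum_{\alpha,j}L^\alpha_{ij}x_j\partial_{z_\alpha}$, $i=1,\dots,k$. The operator $S$ is identified with its matrix, acting on $\mathbb R^k$. A covector $\lambda\in T_e^*G$ is written $\lambda=\sum_iu_i\,dx_i+\sum_\alpha v_\alpha\,dz_\alpha=(u,v)$. **Geodesics.** A horizontal curve with control $u\in L^\infty([0,1],\mathbb R^k)$ is a solution of $\dot\gamma_u(t)=\sum_iu_i(t)X_i(\gamma_u(t))$ for a.e. $t$. A geodesic is a horizontal curve that locally minimizes the energy $\frac12\int g(\dot\gamma,\dot\gamma)\,dt$ between its endpoints. The end-point map $E_e$ sends a control $u$ to $\gamma_u(1)$, with $\gamma_u(0)=e$. A horizontal curve $\gamma_u$ starting from $e$ is abnormal if there is a non-zero $\lambda_1\in T^*_{\gamma_u(1)}G$ with $\lambda_1\circ D_uE_e=0$ (i.e. $u$ is a critical point of $E_e$).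 The Hamiltonian is $H(\lambda)=\frac12\sum_i\langle\lambda,X_i\rangle^2$ on $T^*G$, with Hamiltonian vector field $\vec H$; $\exp_e(\lambda)=\pi(\lambda(1))$, where $\pi:T^*G\to G$ is the projection and $\lambda(t)$ is the integral curve of $\vec H$ with $\lambda(0)=\lambda$. The normal geodesic with initial covector $\lambda$ is $t\mapsto\exp_e(t\lambda)=\pi(\lambda(t))$, $t\in[0,1]$. An abnormal geodesic is a geodesic that is an abnormal curve. *)

theory Defs
  imports "HOL-Analysis.Analysis" "HOL-Probability.Essential_Supremum"
begin

section \<open>Step 2 Carnot algebras and the generalized H-type condition\<close>

definition lie_bracket :: "('g::real_vector \<Rightarrow> 'g \<Rightarrow> 'g) \<Rightarrow> bool" where
  "lie_bracket br \<longleftrightarrow>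
     (\<forall>X. linear (br X)) \<and> (\<forall>Y. linear (\<lambda>X. br X Y)) \<and> (\<forall>X. br X X = 0) \<and>
     (\<forall>X Y Z. br X (br Y Z) + br Y (br Z X) + br Z (br X Y) = 0)"

text \<open>The Lie algebra is the whole type \<open>'g\<close>, and its scalar product is the inner product
  of \<open>'g\<close>.\<close>

definition step2_carnot_algebra ::
    "('g::euclidean_space \<Rightarrow> 'g \<Rightarrow> 'g) \<Rightarrow> 'g set \<Rightarrow> 'g set \<Rightarrow> bool" where
  "step2_carnot_algebra br g1 g2 \<longleftrightarrow>
     lie_bracket br \<and> subspace g1 \<and> subspace g2 \<and>
     (\<forall>X\<in>g1. \<forall>V\<in>g2. X \<bullet> V = 0) \<and>
     (\<forall>Z. \<exists>X\<in>g1. \<exists>V\<in>g2. Z = X + V) \<and>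
     dim g2 \<ge> 1 \<and>
     span {br X Y | X Y. X \<in> g1 \<and> Y \<in> g1} = g2 \<and>
     (\<forall>X\<in>g1. \<forall>V\<in>g2. br X V = 0) \<and> (\<forall>V\<in>g2. \<forall>W\<in>g2. br V W = 0)"

definition J_op :: "('g::euclidean_space \<Rightarrow> 'g \<Rightarrow> 'g) \<Rightarrow> 'g set \<Rightarrow> 'g \<Rightarrow> 'g \<Rightarrow> 'g" where
  "J_op br g1 V Y = (THE W. W \<in> g1 \<and> (\<forall>X\<in>g1. X \<bullet> W = V \<bullet> br X Y))"

text \<open>Only the restriction of \<open>S\<close> to \<open>g1\<close> is constrained.\<close>

definition generalized_H_type ::
    "('g::euclidean_space \<Rightarrow> 'g \<Rightarrow> 'g) \<Rightarrow> 'g set \<Rightarrow> 'g set \<Rightarrow> ('g \<Rightarrow> 'g) \<Rightarrow> bool" where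
  "generalized_H_type br g1 g2 S \<longleftrightarrow>
     step2_carnot_algebra br g1 g2 \<and>
     (\<forall>X\<in>g1. S X \<in> g1) \<and>
     (\<forall>X\<in>g1. \<forall>Y\<in>g1. \<forall>a b. S (a *\<^sub>R X + b *\<^sub>R Y) = a *\<^sub>R S X + b *\<^sub>R S Y) \<and>
     (\<forall>X\<in>g1. \<forall>Y\<in>g1. S X \<bullet> Y = X \<bullet> S Y) \<and>
     (\<forall>X\<in>g1. S X \<bullet> X \<ge> 0) \<and>
     (\<exists>X\<in>g1. S X \<noteq> 0) \<and>
     (\<forall>V\<in>g2. \<forall>W\<in>g2. \<forall>X\<in>g1.
        J_op br g1 V (J_op br g1 W X) + J_op br g1 W (J_op br g1 V X)
          = (- 2 * (V \<bullet> W)) *\<^sub>R S (S X))"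

section \<open>Coordinates and the horizontal frame\<close>

definition orthonormal_basis :: "('i::finite \<Rightarrow> 'g::euclidean_space) \<Rightarrow> 'g set \<Rightarrow> bool" where
  "orthonormal_basis b V \<longleftrightarrow>
     (\<forall>i j. b i \<bullet> b j = (if i = j then 1 else 0)) \<and> span (range b) = V"

definition structure_constants ::
    "('g::euclidean_space \<Rightarrow> 'g \<Rightarrow> 'g) \<Rightarrow> ('k \<Rightarrow> 'g) \<Rightarrow> ('m \<Rightarrow> 'g) \<Rightarrow> 'm \<Rightarrow> 'k \<Rightarrow> 'k \<Rightarrow> real" where
  "structure_constants br e f \<alpha> i j = br (e i) (e j) \<bullet> f \<alpha>"

definition operator_matrix :: "('k::finite \<Rightarrow> 'g::euclidean_space) \<Rightarrow> ('g \<Rightarrow> 'g) \<Rightarrow> real^'k^'k" where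
  "operator_matrix e S = (\<chi> i j. e i \<bullet> S (e j))"

text \<open>Points of the group are given by exponential coordinates \<open>(x, z)\<close>, so the identity is
  \<open>0\<close>; tangent vectors are written in the basis \<open>\<partial>\<^sub>x, \<partial>\<^sub>z\<close> and covectors in the basis
  \<open>dx, dz\<close>, so that the duality pairing is the inner product.\<close>

type_synonym ('k, 'm) point = "(real^'k) \<times> (real^'m)"
type_synonym ('k, 'm) covector = "(real^'k) \<times> (real^'m)"

definition frame ::
    "('m \<Rightarrow> 'k \<Rightarrow> 'k \<Rightarrow> real) \<Rightarrow> 'k \<Rightarrow> ('k::finite, 'm::finite) point \<Rightarrow> (real^'k) \<times> (real^'m)" where
  "frame L i p = (axis i 1, \<chi> \<alpha>. - (1/2) * (\<Sum>j\<in>UNIV. L \<alpha> i j * fst p $ j))"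

text \<open>The simply connected group with Lie algebra \<open>'g\<close> is \<open>'g\<close> itself with the
  Baker-Campbell-Hausdorff product, its exponential map being the identity. In this model the
  vector fields \<open>frame L i\<close> are the left-invariant fields generated by \<open>e i\<close>.\<close>

definition bch_mult :: "('g::real_vector \<Rightarrow> 'g \<Rightarrow> 'g) \<Rightarrow> 'g \<Rightarrow> 'g \<Rightarrow> 'g" where
  "bch_mult br p q = p + q + (1/2) *\<^sub>R br p q"

definition exp_coords ::
    "('k \<Rightarrow> 'g::euclidean_space) \<Rightarrow> ('m \<Rightarrow> 'g) \<Rightarrow> ('k::finite, 'm::finite) point \<Rightarrow> 'g" where
  "exp_coords e f p = (\<Sum>i\<in>UNIV. fst p $ i *\<^sub>R e i) + (\<Sum>\<alpha>\<in>UNIV. snd p $ \<alpha> *\<^sub>R f \<alpha>)"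

lemma orthonormal_basis_expand:
  assumes "orthonormal_basis b V" "v \<in> V"
  shows "v = (\<Sum>i\<in>UNIV. (v \<bullet> b i) *\<^sub>R b i)"
proof -
  have on: "b i \<bullet> b j = (if i = j then 1 else 0)" for i j
    using assms(1) by (auto simp: orthonormal_basis_def)
  let ?w = "\<lambda>v. v - (\<Sum>i\<in>UNIV. (v \<bullet> b i) *\<^sub>R b i)"
  have "v \<in> span (range b)"
    using assms by (auto simp: orthonormal_basis_def)
  then have "?w v = 0"
  proof (induction rule: span_induct_alt)
    case base
    then show ?case by simp
  next
    case (step c x y)
    from step(1) obtain j where j: "x = b j" by auto
    have "?w (c *\<^sub>R x + y) = c *\<^sub>R ?w x + ?w y"
      by (simp add: inner_add_left scaleR_add_left sum.distrib scaleR_sum_right algebra_simps)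
    moreover have "?w x = 0"
      by (simp add: j on if_distrib[where f = "\<lambda>c. c *\<^sub>R _"] sum.delta cong: if_cong)
    ultimately show ?case using step by simp
  qed
  then show ?thesis by simp
qed

lemma frame_left_invariant:
  fixes e :: "'k::finite \<Rightarrow> 'g::euclidean_space" and f :: "'m::finite \<Rightarrow> 'g"
  assumes "step2_carnot_algebra br g1 g2" "orthonormal_basis e g1" "orthonormal_basis f g2"
  shows "((\<lambda>s. bch_mult br (exp_coords e f p) (s *\<^sub>R e i)) has_vector_derivative
            exp_coords e f (frame (structure_constants br e f) i p)) (at 0)"
proof -
  let ?P = "exp_coords e f p" and ?L = "structure_constants br e f"
  have br: "lie_bracket br" and mem: "e j \<in> g1" "f \<alpha> \<in> g2" for j \<alpha>
    using assms by (auto simp: step2_carnot_algebra_def orthonormal_basis_def span_base)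
  have lin1: "linear (br X)" and lin2: "linear (\<lambda>X. br X Y)" and alt: "br X X = 0" for X Y
    using br by (auto simp: lie_bracket_def)
  have skew: "br X Y = - br Y X" for X Y
  proof -
    have "br (X + Y) (X + Y) = br X X + br X Y + (br Y X + br Y Y)"
      using linear_add[OF lin1] linear_add[OF lin2] by (simp add: algebra_simps)
    then have "br X Y + br Y X = 0" by (simp add: alt)
    then show ?thesis by (simp add: eq_neg_iff_add_eq_0)
  qed
  have f0: "br (f \<alpha>) (e i) = 0" for \<alpha>
  proof -
    have "br (e i) (f \<alpha>) = 0"
      using assms(1) mem by (auto simp: step2_carnot_algebra_def)
    then show ?thesis using skew[of "f \<alpha>" "e i"] by simp
  qed
  have ee: "br (e i) (e j) = (\<Sum>\<alpha>\<in>UNIV. ?L \<alpha> i j *\<^sub>R f \<alpha>)" for j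
  proof -
    have "br (e i) (e j) \<in> {br X Y |X Y. X \<in> g1 \<and> Y \<in> g1}" using mem(1) by blast
    then have "br (e i) (e j) \<in> span {br X Y |X Y. X \<in> g1 \<and> Y \<in> g1}" by (rule span_base)
    also have "\<dots> = g2" using assms(1) unfolding step2_carnot_algebra_def by blast
    finally have "br (e i) (e j) \<in> g2" .
    from orthonormal_basis_expand[OF assms(3) this] show ?thesis
      by (simp add: structure_constants_def)
  qed
  have "br ?P (e i) = (\<Sum>j\<in>UNIV. fst p $ j *\<^sub>R br (e j) (e i)) +
      (\<Sum>\<alpha>\<in>UNIV. snd p $ \<alpha> *\<^sub>R br (f \<alpha>) (e i))"
    unfolding exp_coords_def
    by (simp add: linear_add[OF lin2] linear_sum[OF lin2] linear_scale[OF lin2])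
  also have "\<dots> = - (\<Sum>j\<in>UNIV. \<Sum>\<alpha>\<in>UNIV. (?L \<alpha> i j * fst p $ j) *\<^sub>R f \<alpha>)"
    by (subst skew) (simp add: f0 ee sum_negf scaleR_sum_right mult.commute)
  also have "\<dots> = - (\<Sum>\<alpha>\<in>UNIV. (\<Sum>j\<in>UNIV. ?L \<alpha> i j * fst p $ j) *\<^sub>R f \<alpha>)"
    by (subst sum.swap) (simp add: scaleR_sum_left)
  finally have brP: "br ?P (e i) = \<dots>" .
  have fr: "exp_coords e f (frame ?L i p) = e i + (1/2) *\<^sub>R br ?P (e i)"
    unfolding brP
    by (simp add: exp_coords_def frame_def axis_def if_distrib[where f = "\<lambda>c. c *\<^sub>R _"]
        sum.delta scaleR_sum_right sum_negf cong: if_cong)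
  have "(\<lambda>s. bch_mult br ?P (s *\<^sub>R e i)) = (\<lambda>s. ?P + s *\<^sub>R (e i + (1/2) *\<^sub>R br ?P (e i)))"
    by (auto simp: bch_mult_def linear_scale[OF lin1] algebra_simps)
  then show ?thesis
    unfolding fr by (auto intro!: derivative_eq_intros)
qed

section \<open>Horizontal curves, energy and geodesics\<close>

definition Linf :: "real \<Rightarrow> real \<Rightarrow> (real \<Rightarrow> real^'k::finite) set" where
  "Linf a b = {u. u \<in> borel_measurable (lebesgue_on {a..b}) \<and>
                  esssup (lebesgue_on {a..b}) (\<lambda>t. ereal (norm (u t))) < \<infinity>}"

definition Linf_norm :: "real \<Rightarrow> real \<Rightarrow> (real \<Rightarrow> real^'k::finite) \<Rightarrow> real" where
  "Linf_norm a b u = real_of_ereal (esssup (lebesgue_on {a..b}) (\<lambda>t. ereal (norm (u t))))"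

text \<open>Lipschitz continuity in coordinates on a compact interval is Lipschitz continuity for any
  Riemannian distance. It supplies the absolute continuity required of a solution of the control
  system, which is automatically Lipschitz when the control is essentially bounded.\<close>

definition horizontal_curve ::
    "('m \<Rightarrow> 'k \<Rightarrow> 'k \<Rightarrow> real) \<Rightarrow> real \<Rightarrow> real \<Rightarrow> (real \<Rightarrow> real^'k::finite) \<Rightarrow>
     (real \<Rightarrow> ('k, 'm::finite) point) \<Rightarrow> bool" where
  "horizontal_curve L a b u \<gamma> \<longleftrightarrow>
     u \<in> Linf a b \<and> (\<exists>C. C-lipschitz_on {a..b} \<gamma>) \<and>
     (AE t in lebesgue_on {a..b}.
        (\<gamma> has_vector_derivative (\<Sum>i\<in>UNIV. u t $ i *\<^sub>R frame L i (\<gamma> t))) (at t within {a..b}))"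

text \<open>The frame is orthonormal, so \<open>g(\<gamma>', \<gamma>') = |u|\<^sup>2\<close> for a curve \<open>\<gamma>\<close> with control \<open>u\<close>.\<close>

definition energy :: "real \<Rightarrow> real \<Rightarrow> (real \<Rightarrow> real^'k::finite) \<Rightarrow> real" where
  "energy a b u = 1/2 * integral {a..b} (\<lambda>t. (norm (u t))\<^sup>2)"

definition energy_minimizing ::
    "('m \<Rightarrow> 'k \<Rightarrow> 'k \<Rightarrow> real) \<Rightarrow> real \<Rightarrow> real \<Rightarrow> (real \<Rightarrow> real^'k::finite) \<Rightarrow>
     (real \<Rightarrow> ('k, 'm::finite) point) \<Rightarrow> bool" where
  "energy_minimizing L a b u \<gamma> \<longleftrightarrow>
     horizontal_curve L a b u \<gamma> \<and>
     (\<forall>w \<eta>. horizontal_curve L a b w \<eta> \<and> \<eta> a = \<gamma> a \<and> \<eta> b = \<gamma> b \<longrightarrow>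
        energy a b u \<le> energy a b w)"

text \<open>Local minimality is local in time: sufficiently short arcs minimize between their own
  endpoints.\<close>

definition geodesic ::
    "('m \<Rightarrow> 'k \<Rightarrow> 'k \<Rightarrow> real) \<Rightarrow> (real \<Rightarrow> ('k::finite, 'm::finite) point) \<Rightarrow> bool" where
  "geodesic L \<gamma> \<longleftrightarrow>
     (\<exists>u. horizontal_curve L 0 1 u \<gamma> \<and>
       (\<forall>t\<in>{0..1}. \<exists>\<delta>>0. \<forall>a b. a < b \<and> {a..b} \<subseteq> {0..1} \<inter> {t - \<delta>..t + \<delta>} \<longrightarrow>
          energy_minimizing L a b u \<gamma>))"

section \<open>End-point map and abnormal curves\<close>

definition endpoint ::
    "('m \<Rightarrow> 'k \<Rightarrow> 'k \<Rightarrow> real) \<Rightarrow> (real \<Rightarrow> real^'k::finite) \<Rightarrow> ('k, 'm::finite) point" where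
  "endpoint L u = (THE p. \<exists>\<gamma>. horizontal_curve L 0 1 u \<gamma> \<and> \<gamma> 0 = 0 \<and> \<gamma> 1 = p)"

text \<open>Frechet derivative at \<open>u\<close> on the Banach space \<open>L\<^sup>\<infinity>\<close>, in terms of representatives.
  The second clause forces \<open>D\<close> to respect almost everywhere equality.\<close>

definition Linf_has_derivative ::
    "((real \<Rightarrow> real^'k::finite) \<Rightarrow> 'b::real_normed_vector) \<Rightarrow>
     ((real \<Rightarrow> real^'k) \<Rightarrow> 'b) \<Rightarrow> (real \<Rightarrow> real^'k) \<Rightarrow> bool" where
  "Linf_has_derivative F D u \<longleftrightarrow>
     (\<forall>v\<in>Linf 0 1. \<forall>w\<in>Linf 0 1. \<forall>a b.
        D (\<lambda>t. a *\<^sub>R v t + b *\<^sub>R w t) = a *\<^sub>R D v + b *\<^sub>R D w) \<and>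
     (\<exists>K. \<forall>w\<in>Linf 0 1. norm (D w) \<le> K * Linf_norm 0 1 w) \<and>
     (\<forall>\<epsilon>>0. \<exists>\<delta>>0. \<forall>w\<in>Linf 0 1. Linf_norm 0 1 w < \<delta> \<longrightarrow>
        norm (F (\<lambda>t. u t + w t) - F u - D w) \<le> \<epsilon> * Linf_norm 0 1 w)"

definition abnormal_curve ::
    "('m \<Rightarrow> 'k \<Rightarrow> 'k \<Rightarrow> real) \<Rightarrow> (real \<Rightarrow> ('k::finite, 'm::finite) point) \<Rightarrow> bool" where
  "abnormal_curve L \<gamma> \<longleftrightarrow>
     (\<exists>u. horizontal_curve L 0 1 u \<gamma> \<and> \<gamma> 0 = 0 \<and>
       (\<exists>D. Linf_has_derivative (endpoint L) D u \<and>
         (\<exists>\<xi> :: ('k, 'm) covector. \<xi> \<noteq> 0 \<and> (\<forall>w\<in>Linf 0 1. \<xi> \<bullet> D w = 0))))"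

section \<open>Hamiltonian flow and normal geodesics\<close>

definition hamiltonian ::
    "('m \<Rightarrow> 'k \<Rightarrow> 'k \<Rightarrow> real) \<Rightarrow> ('k::finite, 'm::finite) point \<times> ('k, 'm) covector \<Rightarrow> real" where
  "hamiltonian L = (\<lambda>(p, q). 1/2 * (\<Sum>i\<in>UNIV. (q \<bullet> frame L i p)\<^sup>2))"

definition grad :: "('a::real_inner \<Rightarrow> real) \<Rightarrow> 'a \<Rightarrow> 'a" where
  "grad h x = (THE d. GDERIV h x :> d)"

definition hamiltonian_field ::
    "('a::real_inner \<times> 'a \<Rightarrow> real) \<Rightarrow> 'a \<times> 'a \<Rightarrow> 'a \<times> 'a" where
  "hamiltonian_field H = (\<lambda>(p, q). (grad (\<lambda>q'. H (p, q')) q, - grad (\<lambda>p'. H (p', q)) p))"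

definition exp_e ::
    "('m \<Rightarrow> 'k \<Rightarrow> 'k \<Rightarrow> real) \<Rightarrow> ('k::finite, 'm::finite) covector \<Rightarrow> ('k, 'm) point" where
  "exp_e L \<xi> = (THE p. \<exists>c.
     (\<forall>t\<in>{0..1}. (c has_vector_derivative hamiltonian_field (hamiltonian L) (c t))
        (at t within {0..1})) \<and>
     c 0 = (0, \<xi>) \<and> fst (c 1) = p)"

definition normal_geodesic ::
    "('m \<Rightarrow> 'k \<Rightarrow> 'k \<Rightarrow> real) \<Rightarrow> ('k::finite, 'm::finite) covector \<Rightarrow> real \<Rightarrow> ('k, 'm) point" where
  "normal_geodesic L \<xi> t = exp_e L (t *\<^sub>R \<xi>)"

end

theory Submission
  imports Defs
begin

text \<open>
  In coordinates a horizontal curve \<open>(x, z)\<close> with control \<open>u\<close> satisfies \<open>x' = u\<close> and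
  \<open>z' = - B(u, x) / 2\<close> for the skew bracket form \<open>B\<close>. Write \<open>v \<bullet> B(y, x) = y \<bullet> J\<^sub>v x\<close>.
  Since \<open>J\<^sub>v\<^sup>2 = - |v|\<^sup>2 S\<^sup>2\<close> with \<open>J\<^sub>v\<close> skew and \<open>S\<close> symmetric, \<open>ker J\<^sub>v = ker S\<close> for every
  \<open>v \<noteq> 0\<close>; nothing else about the group is needed.

  If \<open>(a, v)\<close> annihilates the differential of the end-point map at \<open>u\<close>, an integration by
  parts turns this into \<open>\<integral> w \<bullet> (a - J\<^sub>v x + J\<^sub>v x(1) / 2) = 0\<close> for all \<open>w\<close>. The second factor
  therefore vanishes identically; its value at time 0 gives \<open>J\<^sub>v x = 0\<close>, so \<open>v \<noteq> 0\<close> and \<open>x\<close>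
  stays in \<open>ker S\<close>. Conversely, for \<open>u\<close> in \<open>ker S\<close> the differential is \<open>w \<mapsto> (\<integral> w, 0)\<close>.

  An abnormal curve thus lies in \<open>ker S \<times> 0\<close>, where line segments are horizontal. Comparing a short
  minimizing arc with its chord shows that it is straight. For the Hamiltonian flow, \<open>h = x'\<close>
  solves \<open>h' = - J\<^sub>v h\<close>, and \<open>|h - u|\<^sup>2\<close> is constant when \<open>J\<^sub>v u = 0\<close>, so that \<open>h = u\<close>.
\<close>

section \<open>Lipschitz curves and almost everywhere derivatives\<close>

lemma AE_lebesgue_on_iff_negligible:
  assumes "S \<in> sets lebesgue"
  shows "(AE t in lebesgue_on S. P t) \<longleftrightarrow> (\<exists>N. negligible N \<and> (\<forall>t\<in>S - N. P t))"
proof -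
  have "(AE t in lebesgue_on S. P t) \<longleftrightarrow> (AE t in lebesgue. t \<in> S \<longrightarrow> P t)"
    using assms by (subst AE_restrict_space_iff) auto
  also have "\<dots> \<longleftrightarrow> (\<exists>N. negligible N \<and> (\<forall>t\<in>S - N. P t))"
  proof
    assume "AE t in lebesgue. t \<in> S \<longrightarrow> P t"
    then obtain N where "{x \<in> space lebesgue. \<not> (x \<in> S \<longrightarrow> P x)} \<subseteq> N" "N \<in> null_sets lebesgue"
      by (auto elim!: AE_E simp: null_sets_def)
    then show "\<exists>N. negligible N \<and> (\<forall>t\<in>S - N. P t)"
      by (intro exI[of _ N]) (auto simp: negligible_iff_null_sets)
  next
    assume "\<exists>N. negligible N \<and> (\<forall>t\<in>S - N. P t)"
    then obtain N where "negligible N" "\<forall>t\<in>S - N. P t" by auto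
    then show "AE t in lebesgue. t \<in> S \<longrightarrow> P t"
      by (intro AE_I'[of N]) (auto simp: negligible_iff_null_sets)
  qed
  finally show ?thesis .
qed

text \<open>On the exceptional null set the increments are bounded by \<open>C\<close> times the lengths of the
  intervals; a gauge for the indicator function of that set makes their sum small.\<close>

lemma has_integral_lipschitz_derivative_AE:
  fixes f :: "real \<Rightarrow> 'a::banach"
  assumes "a \<le> b" and lip: "C-lipschitz_on {a..b} f" and N: "negligible N"
    and der: "\<And>t. t \<in> {a..b} - N \<Longrightarrow> (f has_vector_derivative g t) (at t within {a..b})"
  shows "(g has_integral (f b - f a)) {a..b}"
proof -
  \<comment> \<open>On \<open>N\<close> the values of \<open>g\<close> are arbitrary, so they are
    replaced by 0; a tag in \<open>N\<close> then contributes only an increment of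
    \<open>f\<close>.\<close>
  define h where "h t = (if t \<in> N then 0 else g t)" for t
  have C: "C \<ge> 0" using lip by (rule lipschitz_on_nonneg)
  have "(h has_integral (f b - f a)) (cbox a b)"
    unfolding has_integral
  proof (intro allI impI)
    fix e :: real assume "e > 0"
    \<comment> \<open>Chosen so that the total error \<open>e1 * (b - a) + C * e2\<close> stays
      below \<open>e\<close>: \<open>e1\<close> serves the tags outside \<open>N\<close>,
      \<open>e2\<close> those inside. The \<open>+ 1\<close> keeps the denominators
      positive.\<close>
    define e1 where "e1 = e / (2 * (b - a + 1))"
    define e2 where "e2 = e / (2 * (C + 1))"
    have e1: "e1 > 0" and e2: "e2 > 0"
      using \<open>e > 0\<close> \<open>a \<le> b\<close> C by (auto simp: e1_def e2_def)
    have "(indicat_real N has_integral 0) (cbox a b)"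
      using N by (simp add: negligible_def)
    from this[unfolded has_integral, rule_format, OF e2] obtain \<gamma> where \<gamma>: "gauge \<gamma>"
      "\<And>p. p tagged_division_of cbox a b \<Longrightarrow> \<gamma> fine p \<Longrightarrow>
        norm ((\<Sum>(x,k)\<in>p. measure lborel k *\<^sub>R indicat_real N x) - 0) < e2"
      by auto
    \<comment> \<open>Differentiability outside \<open>N\<close> supplies a second gauge, the ball
      of radius \<open>d x\<close> around the tag; inside \<open>N\<close> any radius will
      do.\<close>
    have "\<forall>x. \<exists>d>0. x \<in> {a..b} - N \<longrightarrow>
       (\<forall>y\<in>{a..b}. norm (y-x) < d \<longrightarrow> norm (f y - f x - (y-x) *\<^sub>R g x) \<le> e1 * norm (y-x))"
    proof
      fix x
      show "\<exists>d>0. x \<in> {a..b} - N \<longrightarrow>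
         (\<forall>y\<in>{a..b}. norm (y-x) < d \<longrightarrow> norm (f y - f x - (y-x) *\<^sub>R g x) \<le> e1 * norm (y-x))"
      proof (cases "x \<in> {a..b} - N")
        case True
        then show ?thesis 
          using der[OF True] e1 unfolding has_vector_derivative_def has_derivative_within_alt by blast
      qed (auto intro: exI[of _ 1])
    qed
    then obtain d where d: "\<And>x. 0 < d x"
      "\<And>x y. x \<in> {a..b} - N \<Longrightarrow> y \<in> {a..b} \<Longrightarrow> norm (y-x) < d x \<Longrightarrow>
          norm (f y - f x - (y-x) *\<^sub>R g x) \<le> e1 * norm (y-x)"
      by metis
    show "\<exists>\<gamma>. gauge \<gamma> \<and> (\<forall>p. p tagged_division_of cbox a b \<and> \<gamma> fine p \<longrightarrow>
            norm ((\<Sum>(x,k)\<in>p. measure lborel k *\<^sub>R h x) - (f b - f a)) < e)"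
    proof (intro exI conjI allI impI)
      show "gauge (\<lambda>x. \<gamma> x \<inter> ball x (d x))"
        using \<gamma>(1) d(1) by (intro gauge_Int gauge_ball_dependent) auto
      fix p assume "p tagged_division_of cbox a b \<and> (\<lambda>x. \<gamma> x \<inter> ball x (d x)) fine p"
      then have p: "p tagged_division_of cbox a b" and f1: "\<gamma> fine p" 
        and f2: "(\<lambda>x. ball x (d x)) fine p"
        by (auto simp: fine_Int)
      have tele: "(\<Sum>(x,k)\<in>p. f (Sup k) - f (Inf k)) = f b - f a"
        using additive_tagged_division_1[OF \<open>a \<le> b\<close>, of p f] p by auto
      have cont: "(\<Sum>(x,k)\<in>p. measure lborel k) = b - a"
        using additive_content_tagged_division[OF p] \<open>a \<le> b\<close> by simp
      have *: "norm (measure lborel k *\<^sub>R h x - (f (Sup k) - f (Inf k)))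
            \<le> e1 * measure lborel k + C * (measure lborel k *\<^sub>R indicat_real N x)"
        if xk: "(x, k) \<in> p" for x k
      proof -
        obtain u v where k: "k = {u..v}" using tagged_division_ofD(4)[OF p xk] by auto
        have xin: "x \<in> {u..v}" and sub: "{u..v} \<subseteq> {a..b}"
          using tagged_division_ofD(2,3)[OF p xk] k by auto
        then have uv: "u \<le> x" "x \<le> v" "u \<in> {a..b}" "v \<in> {a..b}" "x \<in> {a..b}" by auto
        have fine: "{u..v} \<subseteq> ball x (d x)" using f2 xk k by (auto simp: fine_def)
        show ?thesis
        proof (cases "x \<in> N")
          case True
          have "norm (f v - f u) \<le> C * (v - u)"
            using lipschitz_onD[OF lip, of v u] uv by (auto simp: dist_norm)
          moreover have "0 \<le> e1 * (v - u)" using e1 uv by simp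
          ultimately show ?thesis using True uv
            by (simp add: h_def k norm_minus_commute)
        next
          case False
          have "norm (v - x) < d x" "norm (u - x) < d x"
            using subsetD[OF fine, of v] subsetD[OF fine, of u] uv by (auto simp: dist_real_def)
          then have "norm (f v - f x - (v-x) *\<^sub>R g x) \<le> e1 * (v - x)"
            "norm (f u - f x - (u-x) *\<^sub>R g x) \<le> e1 * (x - u)"
            using d(2)[of x v] d(2)[of x u] uv False by auto
          \<comment> \<open>Straddle estimate: as the tag \<open>x\<close> lies between
            \<open>u\<close> and \<open>v\<close>, the errors at the two endpoints add up to
            \<open>e1 * (v - u)\<close>.\<close>
          moreover have "(v - u) *\<^sub>R g x - (f v - f u)
              = (f u - f x - (u-x) *\<^sub>R g x) - (f v - f x - (v-x) *\<^sub>R g x)"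
            by (simp add: algebra_simps)
          ultimately have "norm ((v - u) *\<^sub>R g x - (f v - f u)) \<le> e1 * (x - u) + e1 * (v - x)"
            by (metis norm_triangle_le_diff add_mono)
          then show ?thesis using False uv by (simp add: h_def k algebra_simps)
        qed
      qed
      have "(\<Sum>(x,k)\<in>p. measure lborel k *\<^sub>R h x) - (f b - f a)
          = (\<Sum>(x,k)\<in>p. measure lborel k *\<^sub>R h x - (f (Sup k) - f (Inf k)))"
        unfolding tele[symmetric] by (simp add: sum_subtractf[symmetric] case_prod_unfold)
      also have "norm \<dots> \<le> (\<Sum>(x,k)\<in>p. e1 * measure lborel k + C * (measure lborel k *\<^sub>R indicat_real N x))"
        using * by (intro sum_norm_le) auto
      also have "\<dots> = e1 * (b - a) + C * (\<Sum>(x,k)\<in>p. measure lborel k *\<^sub>R indicat_real N x)"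
        unfolding cont[symmetric] by (simp add: sum.distrib case_prod_unfold sum_distrib_left)
      also have "\<dots> \<le> e1 * (b - a) + C * e2"
        using \<gamma>(2)[OF p f1] C by (intro add_left_mono mult_left_mono) auto
      also have "\<dots> < e1 * (b - a + 1) + (C + 1) * e2"
        using e1 e2 by (simp add: algebra_simps)
      also have "\<dots> = e"
      proof -
        have "e1 * (b - a + 1) = e / 2" "(C + 1) * e2 = e / 2"
          using \<open>a \<le> b\<close> C by (auto simp: e1_def e2_def divide_simps)
        then show ?thesis by simp
      qed
      finally show "norm ((\<Sum>(x,k)\<in>p. measure lborel k *\<^sub>R h x) - (f b - f a)) < e" .
    qed
  qed
  then have "(h has_integral (f b - f a)) {a..b}" by simp
  then show ?thesis
    by (rule has_integral_spike[OF N, rotated]) (simp add: h_def)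
qed

text \<open>Lebesgue differentiation on the line. \<open>integrable_ccontinuous_explicit\<close>
  controls averages over intervals that start at the point, that is, right difference quotients;
  applied to the reflected function it controls the left ones, and its exceptional set is reflected
  back.\<close>

lemma integral_has_vector_derivative_AE:
  fixes u :: "real \<Rightarrow> 'a::euclidean_space"
  assumes u: "u integrable_on {a..b}"
  obtains N where "negligible N"
    "\<And>t. t \<in> {a..b} - N \<Longrightarrow> ((\<lambda>t. integral {a..t} u) has_vector_derivative u t) (at t within {a..b})"
proof -
  \<comment> \<open>Extension by zero makes the function integrable over every interval, as the
    differentiation theorem asks.\<close>
  define f where "f t = (if t \<in> {a..b} then u t else 0)" for t
  have fint: "f integrable_on cbox c d" for c d
  proof -
    have "f integrable_on UNIV" unfolding f_def using u by (subst integrable_restrict_UNIV)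
    then show ?thesis by (rule integrable_on_subcbox) simp
  qed
  have fint': "(\<lambda>t. f (- t)) integrable_on cbox c d" for c d
    using fint[of "-d" "-c"] integrable_reflect[of f "-c" "-d"] by (simp only: minus_minus)
  obtain N1 where N1: "negligible N1" "\<And>x e. x \<notin> N1 \<Longrightarrow> 0 < e \<Longrightarrow>
      \<exists>d>0. \<forall>h. 0 < h \<and> h < d \<longrightarrow>
        norm (integral (cbox x (x + h *\<^sub>R One)) f /\<^sub>R h ^ DIM(real) - f x) < e"
    using integrable_ccontinuous_explicit[OF fint] by metis
  obtain N2 where N2: "negligible N2" "\<And>x e. x \<notin> N2 \<Longrightarrow> 0 < e \<Longrightarrow>
      \<exists>d>0. \<forall>h. 0 < h \<and> h < d \<longrightarrow>
        norm (integral (cbox x (x + h *\<^sub>R One)) (\<lambda>t. f (- t)) /\<^sub>R h ^ DIM(real) - f (- x)) < e"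
    using integrable_ccontinuous_explicit[OF fint'] by metis
  have scale: "norm (I - h *\<^sub>R c) \<le> e * h" if "norm (I /\<^sub>R h - c) < e" "h > 0" for I c :: 'a and e h
  proof -
    have "norm (I - h *\<^sub>R c) = norm (h *\<^sub>R (I /\<^sub>R h - c))"
      using \<open>h > 0\<close> by (simp add: algebra_simps)
    also have "\<dots> = h * norm (I /\<^sub>R h - c)" using \<open>h > 0\<close> by simp
    also have "\<dots> \<le> h * e" using that by (intro mult_left_mono) auto
    finally show ?thesis by (simp add: mult.commute)
  qed
  have Iu: "integral {a..d} u - integral {a..c} u = integral {c..d} f"
    if "a \<le> c" "c \<le> d" "d \<le> b" for c d
  proof -
    have "u integrable_on {a..d}" using u by (rule integrable_on_subinterval) (use that in auto)
    then have "integral {a..c} u + integral {c..d} u = integral {a..d} u"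
      using that by (intro Henstock_Kurzweil_Integration.integral_combine) auto
    moreover have "integral {c..d} u = integral {c..d} f"
      by (rule integral_cong) (use that in \<open>auto simp: f_def\<close>)
    ultimately show ?thesis by (simp add: algebra_simps)
  qed
  show ?thesis
  proof (rule that[of "N1 \<union> uminus ` N2"])
    show "negligible (N1 \<union> uminus ` N2)"
      using N1(1) N2(1)
      by (intro negligible_Un negligible_differentiable_image_negligible) (auto intro!: derivative_intros)
    fix t assume t: "t \<in> {a..b} - (N1 \<union> uminus ` N2)"
    then have tN: "t \<notin> N1" "- t \<notin> N2" and tab: "a \<le> t" "t \<le> b" and ft: "f t = u t"
      by (auto simp: f_def image_iff)
    show "((\<lambda>t. integral {a..t} u) has_vector_derivative u t) (at t within {a..b})"
      unfolding has_vector_derivative_def has_derivative_within_alt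
    proof (intro conjI allI impI)
      show "bounded_linear (\<lambda>x. x *\<^sub>R u t)" by (rule bounded_linear_scaleR_left)
      fix e :: real assume "e > 0"
      obtain d1 where d1: "d1 > 0" "\<And>h. 0 < h \<Longrightarrow> h < d1 \<Longrightarrow> norm (integral {t..t+h} f /\<^sub>R h - f t) < e"
        using N1(2)[OF tN(1) \<open>e > 0\<close>] by auto
      obtain d2 where d2: "d2 > 0" "\<And>h. 0 < h \<Longrightarrow> h < d2 \<Longrightarrow>
          norm (integral {-t..-t+h} (\<lambda>t. f (- t)) /\<^sub>R h - f t) < e"
        using N2(2)[OF tN(2) \<open>e > 0\<close>] by auto
      show "\<exists>d>0. \<forall>y\<in>{a..b}. norm (y - t) < d \<longrightarrow>
          norm (integral {a..y} u - integral {a..t} u - (y - t) *\<^sub>R u t) \<le> e * norm (y - t)"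
      proof (intro exI[of _ "min d1 d2"] conjI ballI impI)
        show "min d1 d2 > 0" using d1 d2 by simp
        fix y assume y: "y \<in> {a..b}" "norm (y - t) < min d1 d2"
        consider "y = t" | "y > t" | "y < t" by linarith
        then show "norm (integral {a..y} u - integral {a..t} u - (y - t) *\<^sub>R u t) \<le> e * norm (y - t)"
        proof cases
          case 2
          have "norm (integral {t..y} f /\<^sub>R (y - t) - f t) < e"
            using d1(2)[of "y - t"] 2 y by simp
          from scale[OF this] show ?thesis
            using 2 y tab by (subst Iu) (auto simp: ft)
        next
          case 3
          have "norm (integral {-t..-y} (\<lambda>t. f (- t)) /\<^sub>R (t - y) - f t) < e"
            using d2(2)[of "t - y"] 3 y by simp
          from scale[OF this] have "norm (integral {y..t} f - (t - y) *\<^sub>R u t) \<le> e * (t - y)"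
            using 3 by (simp add: ft)
          moreover have "integral {a..y} u - integral {a..t} u - (y - t) *\<^sub>R u t
             = - (integral {y..t} f - (t - y) *\<^sub>R u t)"
            using Iu[of y t] 3 y tab by (simp add: algebra_simps)
          ultimately show ?thesis using 3 by (simp only: norm_minus_cancel) auto
        qed simp
      qed
    qed
  qed
qed

section \<open>Essentially bounded functions and their primitives\<close>

definition ess_bounded :: "real \<Rightarrow> real \<Rightarrow> (real \<Rightarrow> 'a::euclidean_space) \<Rightarrow> bool" where
  "ess_bounded a b u \<longleftrightarrow> u \<in> borel_measurable (lebesgue_on {a..b}) \<and>
     (\<exists>C. AE t in lebesgue_on {a..b}. norm (u t) \<le> C)"

lemma ess_bounded_integrable:
  assumes "ess_bounded a b u"
  shows "u integrable_on {a..b}"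
proof -
  obtain C where "AE t in lebesgue_on {a..b}. norm (u t) \<le> C" "u \<in> borel_measurable (lebesgue_on {a..b})"
    using assms by (auto simp: ess_bounded_def)
  then have "integrable (lebesgue_on {a..b}) u"
    by (intro finite_measure.integrable_const_bound finite_measure_lebesgue_on) auto
  then show ?thesis by (intro integrable_on_lebesgue_on) auto
qed

lemma continuous_on_imp_ess_bounded:
  fixes u :: "real \<Rightarrow> 'a::euclidean_space"
  assumes "continuous_on {a..b} u"
  shows "ess_bounded a b u"
proof -
  have "bounded (u ` {a..b})" using assms by (intro compact_imp_bounded compact_continuous_image) auto
  then obtain C where "\<And>t. t \<in> {a..b} \<Longrightarrow> norm (u t) \<le> C" unfolding bounded_iff by blast
  then show ?thesis using assms
    by (auto simp: ess_bounded_def intro!: continuous_imp_measurable_on_sets_lebesgue AE_I2 exI[of _ C])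
qed

text \<open>One closure property serves brackets, inner products and, with a constant first factor,
  linear images.\<close>

lemma ess_bounded_bilinear:
  fixes B :: "'a::euclidean_space \<Rightarrow> 'b::euclidean_space \<Rightarrow> 'c::euclidean_space"
  assumes B: "bounded_bilinear B" and u: "ess_bounded a b u" and w: "ess_bounded a b w"
  shows "ess_bounded a b (\<lambda>t. B (u t) (w t))"
proof -
  interpret bounded_bilinear B by fact
  obtain K where K: "\<And>x y. norm (B x y) \<le> norm x * norm y * K" "K > 0" using pos_bounded by auto
  obtain C D where CD: "AE t in lebesgue_on {a..b}. norm (u t) \<le> C"
    "AE t in lebesgue_on {a..b}. norm (w t) \<le> D" using u w by (auto simp: ess_bounded_def)
  have "AE t in lebesgue_on {a..b}. norm (B (u t) (w t)) \<le> C * D * K"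
    using CD
  proof eventually_elim
    case (elim t)
    have "norm (u t) * norm (w t) * K \<le> C * D * K"
      \<comment> \<open>The bounds \<open>C\<close> and \<open>D\<close> are nonnegative here
        because they dominate norms at the point \<open>t\<close>.\<close>
      using elim K(2) by (intro mult_right_mono mult_mono) (auto intro: order_trans[OF norm_ge_zero])
    then show ?case using K(1) order_trans by blast
  qed
  moreover have "continuous_on UNIV (\<lambda>p. B (fst p) (snd p))"
    by (intro continuous_on continuous_intros)
  then have "(\<lambda>p. B (fst p) (snd p)) \<in> borel_measurable (borel \<Otimes>\<^sub>M borel)"
    by (simp add: borel_prod borel_measurable_continuous_onI)
  from measurable_compose[OF measurable_Pair this] have "(\<lambda>t. B (u t) (w t)) \<in> borel_measurable (lebesgue_on {a..b})"
    using u w by (auto simp: ess_bounded_def)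
  ultimately show ?thesis by (auto simp: ess_bounded_def)
qed

lemma ess_bounded_linear:
  fixes h :: "'a::euclidean_space \<Rightarrow> 'c::euclidean_space"
  assumes h: "bounded_linear h" and u: "ess_bounded a b u"
  shows "ess_bounded a b (\<lambda>t. h (u t))"
proof -
  interpret bounded_linear h by fact
  \<comment> \<open>A linear map becomes bilinear through a scalar factor, which is then set to
    1.\<close>
  have "bounded_bilinear (\<lambda>(s::real) x. s *\<^sub>R h x)"
    by (rule bounded_bilinear.comp[OF bounded_bilinear_scaleR bounded_linear_ident h])
  from ess_bounded_bilinear[OF this continuous_on_imp_ess_bounded[of a b "\<lambda>_. 1"] u]
  show ?thesis by simp
qed

lemma ess_bounded_add:
  assumes u: "ess_bounded a b u" and w: "ess_bounded a b w"
  shows "ess_bounded a b (\<lambda>t. u t + w t)"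
proof -
  obtain C D where CD: "AE t in lebesgue_on {a..b}. norm (u t) \<le> C"
    "AE t in lebesgue_on {a..b}. norm (w t) \<le> D" using u w by (auto simp: ess_bounded_def)
  then have "AE t in lebesgue_on {a..b}. norm (u t + w t) \<le> C + D"
    by eventually_elim (rule norm_triangle_mono)
  then show ?thesis using u w by (auto simp: ess_bounded_def)
qed

lemma ess_bounded_scaleR:
  "ess_bounded a b u \<Longrightarrow> ess_bounded a b (\<lambda>t. c *\<^sub>R u t)"
  by (rule ess_bounded_linear[OF bounded_linear_scaleR_right])

lemma ess_bounded_integral_lipschitz:
  assumes u: "ess_bounded a b u" and C: "AE t in lebesgue_on {a..b}. norm (u t) \<le> C" "C \<ge> 0"
  shows "C-lipschitz_on {a..b} (\<lambda>t. integral {a..t} u)"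
proof (rule lipschitz_on_leI)
  obtain N where N: "negligible N" "\<And>t. t \<in> {a..b} - N \<Longrightarrow> norm (u t) \<le> C"
    using C by (auto simp: AE_lebesgue_on_iff_negligible)
  fix s t assume st: "s \<in> {a..b}" "t \<in> {a..b}" "s \<le> t"
  have uI: "u integrable_on {c..d}" if "a \<le> c" "d \<le> b" for c d
    using ess_bounded_integrable[OF u] by (rule integrable_on_subinterval) (use that in auto)
  have "integral {a..s} u + integral {s..t} u = integral {a..t} u"
    using st uI by (intro Henstock_Kurzweil_Integration.integral_combine) auto
  moreover have "norm (integral {s..t} u) \<le> C * (t - s)"
  proof -
    have "(u has_integral integral {s..t} u) {s..t}" using uI st by (simp add: integrable_integral)
    \<comment> \<open>\<open>has_integral_bound\<close> asks for a bound at every point, so the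
      values on the null set are replaced by 0, which satisfies it since
      \<open>C \<ge> 0\<close>.\<close>
    then have "((\<lambda>r. if r \<in> N then 0 else u r) has_integral integral {s..t} u) {s..t}"
      by (rule has_integral_spike[OF N(1), rotated]) auto
    from has_integral_bound[OF C(2) this[folded box_real]] show ?thesis
      using N(2) C(2) st by auto
  qed
  ultimately show "dist (integral {a..s} u) (integral {a..t} u) \<le> C * dist s t"
    using st by (simp add: dist_norm) (metis add_diff_cancel_left' norm_minus_commute)
qed (fact C)

text \<open>\<open>ess_bounded\<close> trades the extended real supremum for the existence of a
  bound and admits any Euclidean codomain, so that one calculus covers controls, brackets and inner
  products.\<close>

lemma Linf_iff_ess_bounded: "u \<in> Linf a b \<longleftrightarrow> ess_bounded a b u"
proof
  assume "u \<in> Linf a b"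
  then have m: "u \<in> borel_measurable (lebesgue_on {a..b})" 
    and fin: "esssup (lebesgue_on {a..b}) (\<lambda>t. ereal (norm (u t))) < \<infinity>" by (auto simp: Linf_def)
  obtain C where "esssup (lebesgue_on {a..b}) (\<lambda>t. ereal (norm (u t))) \<le> ereal C"
    using fin by (cases "esssup (lebesgue_on {a..b}) (\<lambda>t. ereal (norm (u t)))") auto
  with esssup_AE[of "\<lambda>t. ereal (norm (u t))" "lebesgue_on {a..b}"]
  have "AE t in lebesgue_on {a..b}. norm (u t) \<le> C"
    by (elim eventually_mono) (metis ereal_less_eq(3) order_trans)
  then show "ess_bounded a b u" using m by (auto simp: ess_bounded_def)
next
  assume "ess_bounded a b u"
  then obtain C where m: "u \<in> borel_measurable (lebesgue_on {a..b})" 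
    and C: "AE t in lebesgue_on {a..b}. norm (u t) \<le> C" by (auto simp: ess_bounded_def)
  have "esssup (lebesgue_on {a..b}) (\<lambda>t. ereal (norm (u t))) \<le> ereal C"
    using m C by (intro esssup_I) auto
  then show "u \<in> Linf a b" using m by (auto simp: Linf_def intro: le_less_trans)
qed

text \<open>\<open>real_of_ereal\<close> loses nothing here: the supremum is finite by membership in
  \<open>Linf\<close>, and nonnegative because \<open>a < b\<close> gives the interval positive
  measure. On a null space the essential supremum would be -\<infinity>.\<close>

lemma esssup_norm_eq_Linf_norm:
  assumes "u \<in> Linf a b" "a < b"
  shows "esssup (lebesgue_on {a..b}) (\<lambda>t. ereal (norm (u t))) = ereal (Linf_norm a b u)"
    "Linf_norm a b u \<ge> 0"
proof -
  let ?E = "esssup (lebesgue_on {a..b}) (\<lambda>t. ereal (norm (u t)))"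
  have m: "u \<in> borel_measurable (lebesgue_on {a..b})" and fin: "?E < \<infinity>"
    using assms by (auto simp: Linf_def)
  have "0 = esssup (lebesgue_on {a..b}) (\<lambda>t. 0::ereal)"
    using \<open>a < b\<close> by (subst esssup_const) (auto simp: emeasure_restrict_space)
  also have "\<dots> \<le> ?E" by (intro esssup_mono) (use m in auto)
  finally have ge: "0 \<le> ?E" .
  then show E: "?E = ereal (Linf_norm a b u)"
    using fin by (auto simp: Linf_norm_def ereal_real)
  show "Linf_norm a b u \<ge> 0" using ge unfolding E by simp
qed

lemma AE_le_Linf_norm:
  assumes "u \<in> Linf a b" "a < b"
  shows "AE t in lebesgue_on {a..b}. norm (u t) \<le> Linf_norm a b u"
  using esssup_AE[of "\<lambda>t. ereal (norm (u t))" "lebesgue_on {a..b}"]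
  unfolding esssup_norm_eq_Linf_norm(1)[OF assms] by simp

lemma Linf_norm_le:
  assumes u: "u \<in> Linf a b" "a < b" and C: "AE t in lebesgue_on {a..b}. norm (u t) \<le> C"
  shows "Linf_norm a b u \<le> C"
proof -
  have "esssup (lebesgue_on {a..b}) (\<lambda>t. ereal (norm (u t))) \<le> ereal C"
    using u C by (intro esssup_I) (auto simp: Linf_def)
  then show ?thesis unfolding esssup_norm_eq_Linf_norm(1)[OF u] by simp
qed

lemma Linf_norm_scaleR_le:
  assumes "u \<in> Linf a b" "a < b"
  shows "Linf_norm a b (\<lambda>t. c *\<^sub>R u t) \<le> \<bar>c\<bar> * Linf_norm a b u"
proof (rule Linf_norm_le)
  show "AE t in lebesgue_on {a..b}. norm (c *\<^sub>R u t) \<le> \<bar>c\<bar> * Linf_norm a b u"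
    using AE_le_Linf_norm[OF assms] by eventually_elim (simp add: mult_left_mono)
qed (use assms in \<open>auto simp: Linf_iff_ess_bounded ess_bounded_scaleR\<close>)

text \<open>Converse of \<open>has_integral_lipschitz_derivative_AE\<close>. Together they make the
  differential and the integral form of the control system interchangeable.\<close>

lemma integral_curve_derivative_AE:
  fixes u :: "real \<Rightarrow> 'a::euclidean_space"
  assumes u: "ess_bounded a b u" and f: "\<And>t. t \<in> {a..b} \<Longrightarrow> f t = c + integral {a..t} u"
  shows "\<exists>C. C-lipschitz_on {a..b} f"
    "AE t in lebesgue_on {a..b}. (f has_vector_derivative u t) (at t within {a..b})"
proof -
  obtain C where "AE t in lebesgue_on {a..b}. norm (u t) \<le> C" using u by (auto simp: ess_bounded_def)
  \<comment> \<open>A Lipschitz constant must be nonnegative, whereas \<open>C\<close> may be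
    negative when the interval is null.\<close>
  then have "AE t in lebesgue_on {a..b}. norm (u t) \<le> max C 0" by (elim eventually_mono) auto
  from ess_bounded_integral_lipschitz[OF u this]
  have "(max C 0)-lipschitz_on {a..b} f" by (simp add: lipschitz_on_def f dist_norm)
  then show "\<exists>C. C-lipschitz_on {a..b} f" by blast
  obtain N where N: "negligible N" "\<And>t. t \<in> {a..b} - N \<Longrightarrow>
      ((\<lambda>t. integral {a..t} u) has_vector_derivative u t) (at t within {a..b})"
    using integral_has_vector_derivative_AE[OF ess_bounded_integrable[OF u]] by metis
  have "(f has_vector_derivative u t) (at t within {a..b})" if "t \<in> {a..b} - N" for t
  proof (rule has_vector_derivative_transform)
    show "((\<lambda>t. c + integral {a..t} u) has_vector_derivative u t) (at t within {a..b})"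
      using has_vector_derivative_add[OF has_vector_derivative_const N(2)[OF that]] by simp
  qed (use that f in auto)
  then show "AE t in lebesgue_on {a..b}. (f has_vector_derivative u t) (at t within {a..b})"
    using N(1) by (auto simp: AE_lebesgue_on_iff_negligible)
qed

lemma has_integral_lipschitz_derivative_AE_subinterval:
  fixes f :: "real \<Rightarrow> 'a::banach"
  assumes lip: "\<exists>C. C-lipschitz_on {a..b} f"
    and der: "AE t in lebesgue_on {a..b}. (f has_vector_derivative g t) (at t within {a..b})"
    and t: "t \<in> {a..b}"
  shows "(g has_integral (f t - f a)) {a..t}"
proof -
  obtain C where "C-lipschitz_on {a..b} f" using lip by blast
  then have C: "C-lipschitz_on {a..t} f" by (rule lipschitz_on_subset) (use t in auto)
  obtain N where N: "negligible N" "\<And>s. s \<in> {a..b} - N \<Longrightarrow> (f has_vector_derivative g s) (at s within {a..b})"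
    using der by (auto simp: AE_lebesgue_on_iff_negligible)
  show ?thesis
    by (rule has_integral_lipschitz_derivative_AE[OF _ C N(1)])
      (use t in \<open>auto intro!: has_vector_derivative_within_subset[OF N(2)]\<close>)
qed

lemma integral_cong_AE_lebesgue_on:
  assumes "AE t in lebesgue_on {a..b}. f t = g t"
  shows "integral {a..b::real} f = integral {a..b} g"
proof -
  obtain N where "negligible N" "\<And>t. t \<in> {a..b} - N \<Longrightarrow> f t = g t"
    using assms by (auto simp: AE_lebesgue_on_iff_negligible)
  then show ?thesis by (intro integral_spike[of N]) auto
qed

lemma norm_integral_le_AE:
  assumes u: "ess_bounded a b u" and C: "AE t in lebesgue_on {a..b}. norm (u t) \<le> C" "C \<ge> 0" 
    and "t \<in> {a..b}"
  shows "norm (integral {a..t} u) \<le> C * (t - a)"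
  using lipschitz_onD[OF ess_bounded_integral_lipschitz[OF u C], of t a] \<open>t \<in> {a..b}\<close>
  by (auto simp: dist_norm)

lemma ess_bounded_integral: "ess_bounded a b u \<Longrightarrow> ess_bounded a b (\<lambda>t. integral {a..t} u)"
  using integral_curve_derivative_AE(1)[of a b u "\<lambda>t. integral {a..t} u" 0]
    continuous_on_imp_ess_bounded[OF lipschitz_on_continuous_on] by fastforce

lemma integral_add_scaleR:
  assumes "ess_bounded a b u" "ess_bounded a b w" "t \<in> {a..b}"
  shows "integral {a..t} (\<lambda>r. u r + s *\<^sub>R w r) = integral {a..t} u + s *\<^sub>R integral {a..t} w"
proof -
  have "f integrable_on {a..t}" if "ess_bounded a b f" for f :: "real \<Rightarrow> 'a"
    using ess_bounded_integrable[OF that] by (rule integrable_on_subinterval) (use assms(3) in auto)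
  then show ?thesis using assms
    by (subst integral_add) (auto intro: integrable_cmul)
qed

lemma lipschitz_on_imp_norm_bounded:
  fixes f :: "real \<Rightarrow> 'a::real_normed_vector"
  assumes "C-lipschitz_on {a..b} f"
  shows "\<exists>P\<ge>0. \<forall>t\<in>{a..b}. norm (f t) \<le> P"
proof -
  have "compact (f ` {a..b})"
    by (rule compact_continuous_image[OF lipschitz_on_continuous_on[OF assms]]) simp
  then show ?thesis
    using compact_imp_bounded[of "f ` {a..b}"] unfolding bounded_pos by (meson imageI less_imp_le)
qed

text \<open>The product of two Lipschitz primitives is again Lipschitz and obeys the product rule
  almost everywhere, so it is the integral of its derivative. The boundary term at \<open>a\<close>
  vanishes because both primitives start at 0.\<close>

lemma integral_by_parts_bilinear:
  fixes B :: "'a::euclidean_space \<Rightarrow> 'b::euclidean_space \<Rightarrow> 'c::euclidean_space"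
  assumes B: "bounded_bilinear B" and "a \<le> b" and u: "ess_bounded a b u" and w: "ess_bounded a b w"
  shows "((\<lambda>t. B (integral {a..t} u) (w t) + B (u t) (integral {a..t} w)) has_integral
      B (integral {a..b} u) (integral {a..b} w)) {a..b}"
proof -
  interpret bounded_bilinear B by fact
  let ?x = "\<lambda>t. integral {a..t} u" and ?y = "\<lambda>t. integral {a..t} w"
  note X = integral_curve_derivative_AE[OF u, of ?x 0, simplified]
  note Y = integral_curve_derivative_AE[OF w, of ?y 0, simplified]
  have "\<exists>C. C-lipschitz_on {a..b} (\<lambda>t. B (?x t) (?y t))"
  proof -
    obtain C D where C: "C-lipschitz_on {a..b} ?x" and D: "D-lipschitz_on {a..b} ?y"
      using X(1) Y(1) by blast
    obtain P where P0: "P \<ge> 0" and P: "\<And>t. t \<in> {a..b} \<Longrightarrow> norm (?x t) \<le> P"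
      using lipschitz_on_imp_norm_bounded[OF C] by blast
    obtain Q where Q0: "Q \<ge> 0" and Q: "\<And>t. t \<in> {a..b} \<Longrightarrow> norm (?y t) \<le> Q"
      using lipschitz_on_imp_norm_bounded[OF D] by blast
    obtain K where K: "K \<ge> 0" "\<And>x y. norm (B x y) \<le> norm x * norm y * K" using nonneg_bounded by auto
    have C0: "C \<ge> 0" and D0: "D \<ge> 0" using C D lipschitz_on_nonneg by auto
    have "(C * Q * K + P * D * K)-lipschitz_on {a..b} (\<lambda>t. B (?x t) (?y t))"
    proof (rule lipschitz_onI)
      fix s t assume st: "s \<in> {a..b}" "t \<in> {a..b}"
      have "B (?x s) (?y s) - B (?x t) (?y t) = B (?x s - ?x t) (?y s) + B (?x t) (?y s - ?y t)"
        by (simp add: diff_left diff_right)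
      also have "norm \<dots> \<le> norm (?x s - ?x t) * norm (?y s) * K + norm (?x t) * norm (?y s - ?y t) * K"
        by (intro norm_triangle_mono K)
      also have "\<dots> \<le> (C * dist s t) * Q * K + P * (D * dist s t) * K"
        using lipschitz_onD[OF C st] lipschitz_onD[OF D st] P[OF st(2)] Q[OF st(1)] P0 Q0 C0 D0 K(1)
        by (intro add_mono mult_mono) (auto simp: dist_norm)
      finally show "dist (B (?x s) (?y s)) (B (?x t) (?y t)) \<le> (C * Q * K + P * D * K) * dist s t"
        by (simp add: dist_norm algebra_simps)
    qed (use C0 D0 P0 Q0 K(1) in auto)
    then show ?thesis by blast
  qed
  moreover have "AE t in lebesgue_on {a..b}. ((\<lambda>t. B (?x t) (?y t)) has_vector_derivative
      B (?x t) (w t) + B (u t) (?y t)) (at t within {a..b})"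
    using X(2) Y(2) by eventually_elim (rule has_vector_derivative)
  ultimately show ?thesis
    using has_integral_lipschitz_derivative_AE_subinterval[of a b _ _ b] \<open>a \<le> b\<close>
    by (fastforce simp: zero_left zero_right)
qed

section \<open>The bracket form of a generalized H-type algebra\<close>

definition bracket_form ::
    "('m::finite \<Rightarrow> 'k::finite \<Rightarrow> 'k \<Rightarrow> real) \<Rightarrow> real^'k \<Rightarrow> real^'k \<Rightarrow> real^'m" where
  "bracket_form L x y = (\<chi> \<alpha>. \<Sum>i\<in>UNIV. \<Sum>j\<in>UNIV. x $ i * L \<alpha> i j * y $ j)"

lemma bounded_bilinear_bracket_form: "bounded_bilinear (bracket_form L)"
proof -
  have "bilinear (bracket_form L)"
    unfolding bilinear_def
    by (auto intro!: linearI
        simp: bracket_form_def vec_eq_iff algebra_simps sum.distrib sum_distrib_left)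
  then show ?thesis by (simp add: bilinear_conv_bounded_bilinear)
qed

text \<open>\<open>bracket_adjoint L v\<close> is the operator \<open>J\<^sub>v\<close> in coordinates.\<close>

definition bracket_adjoint ::
    "('m::finite \<Rightarrow> 'k::finite \<Rightarrow> 'k \<Rightarrow> real) \<Rightarrow> real^'m \<Rightarrow> real^'k \<Rightarrow> real^'k" where
  "bracket_adjoint L v x = (\<chi> i. v \<bullet> bracket_form L (axis i 1) x)"

text \<open>For standard basis vectors \<open>y\<close> this is the definition of
  \<open>bracket_adjoint\<close>; linearity in \<open>y\<close> does the rest.\<close>

lemma inner_bracket_form:
  "v \<bullet> bracket_form L y x = y \<bullet> bracket_adjoint L v x"
proof -
  interpret bounded_bilinear "bracket_form L" by (rule bounded_bilinear_bracket_form)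
  have "y = (\<Sum>i\<in>UNIV. y $ i *\<^sub>R axis i 1)"
    by (simp add: vec_eq_iff axis_def if_distrib[where f = "(*) _"] sum.delta cong: if_cong)
  then have "bracket_form L y x = (\<Sum>i\<in>UNIV. y $ i *\<^sub>R bracket_form L (axis i 1) x)"
    by (metis (no_types, lifting) scaleR_left sum.cong sum_left)
  then show ?thesis by (simp add: inner_sum_right) (simp add: inner_vec_def bracket_adjoint_def)
qed

lemma bounded_linear_bracket_adjoint: "bounded_linear (bracket_adjoint L v)"
proof -
  interpret bounded_bilinear "bracket_form L" by (rule bounded_bilinear_bracket_form)
  show ?thesis
    by (auto intro!: linearI simp: linear_conv_bounded_linear[symmetric] bracket_adjoint_def
        vec_eq_iff add_right scaleR_right inner_add_right)
qed

lemma bracket_adjoint_zero [simp]: "bracket_adjoint L 0 x = 0"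
  by (simp add: bracket_adjoint_def vec_eq_iff)

text \<open>The \<open>THE\<close> in \<open>J_op\<close> is well defined: it is the Riesz
  representative on \<open>g1\<close> of the functional sending \<open>X\<close> to
  \<open>V \<bullet> br X Y\<close>.\<close>

lemma J_op_adjoint:
  fixes br :: "'g::euclidean_space \<Rightarrow> 'g \<Rightarrow> 'g" and e :: "'k::finite \<Rightarrow> 'g"
  assumes lin: "\<And>Y. linear (\<lambda>X. br X Y)" and e: "orthonormal_basis e g1"
  shows "J_op br g1 V Y \<in> g1" "\<And>X. X \<in> g1 \<Longrightarrow> X \<bullet> J_op br g1 V Y = V \<bullet> br X Y"
proof -
  have sub: "subspace g1" and mem: "e i \<in> g1" for i
    using e by (auto simp: orthonormal_basis_def span_base)
  let ?P = "\<lambda>W. W \<in> g1 \<and> (\<forall>X\<in>g1. X \<bullet> W = V \<bullet> br X Y)"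
  have "?P (J_op br g1 V Y)"
    unfolding J_op_def
  proof (rule theI)
    \<comment> \<open>The coordinates of the representative are the values of the functional on the
      orthonormal basis.\<close>
    let ?W = "\<Sum>i\<in>UNIV. (V \<bullet> br (e i) Y) *\<^sub>R e i"
    have "X \<bullet> ?W = V \<bullet> br X Y" if "X \<in> g1" for X
    proof -
      have "br X Y = br (\<Sum>i\<in>UNIV. (X \<bullet> e i) *\<^sub>R e i) Y"
        using orthonormal_basis_expand[OF e that] by simp
      also have "\<dots> = (\<Sum>i\<in>UNIV. (X \<bullet> e i) *\<^sub>R br (e i) Y)"
        by (simp add: linear_sum[OF lin] linear_scale[OF lin])
      finally show ?thesis by (simp add: inner_sum_right mult.commute)
    qed
    then show "?P ?W"
      using sub mem by (auto intro!: subspace_sum subspace_scale)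
    fix W assume W: "?P W"
    \<comment> \<open>Two representatives agree against every element of \<open>g1\<close>, in
      particular against their own difference.\<close>
    have "(W - ?W) \<bullet> (W - ?W) = 0"
    proof -
      have "W - ?W \<in> g1" using W \<open>?P ?W\<close> sub subspace_diff by blast
      then have "(W - ?W) \<bullet> W = V \<bullet> br (W - ?W) Y" "(W - ?W) \<bullet> ?W = V \<bullet> br (W - ?W) Y"
        using W \<open>?P ?W\<close> by blast+
      then show ?thesis by (simp only: inner_diff_right)
    qed
    then show "W = ?W" by simp
  qed
  then show "J_op br g1 V Y \<in> g1" "\<And>X. X \<in> g1 \<Longrightarrow> X \<bullet> J_op br g1 V Y = V \<bullet> br X Y" by auto
qed

text \<open>All that is used of the generalized H-type condition; \<open>M\<close> plays the role of \<open>S\<close>.\<close>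

locale kernel_form =
  fixes L :: "'m::finite \<Rightarrow> 'k::finite \<Rightarrow> 'k \<Rightarrow> real" and M :: "real^'k^'k"
  assumes skew: "bracket_form L x y = - bracket_form L y x"
    and kernel: "M *v x = 0 \<Longrightarrow> bracket_form L y x = 0"
    and nondegenerate: "v \<noteq> 0 \<Longrightarrow> (\<And>y. v \<bullet> bracket_form L y x = 0) \<Longrightarrow> M *v x = 0"

text \<open>The linear coordinate maps \<open>E\<close> and \<open>F\<close> turn the form into
  \<open>F v \<bullet> br (E x) (E y)\<close>. Both kernel conditions then follow from |J_V X| = |V|
  |S X|: this vanishes when S X = 0 and, for nonzero V, only then.\<close>

lemma generalized_H_type_kernel_form:
  fixes br :: "'g::euclidean_space \<Rightarrow> 'g \<Rightarrow> 'g" and e :: "'k::finite \<Rightarrow> 'g" and f :: "'m::finite \<Rightarrow> 'g"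
  assumes H: "generalized_H_type br g1 g2 S"
    and e: "orthonormal_basis e g1" and f: "orthonormal_basis f g2"
  shows "kernel_form (structure_constants br e f) (operator_matrix e S)"
proof -
  let ?L = "structure_constants br e f" and ?M = "operator_matrix e S"
  have carnot: "step2_carnot_algebra br g1 g2" and Sg: "\<And>X. X \<in> g1 \<Longrightarrow> S X \<in> g1"
    and Slin: "\<And>X Y a b. X \<in> g1 \<Longrightarrow> Y \<in> g1 \<Longrightarrow> S (a *\<^sub>R X + b *\<^sub>R Y) = a *\<^sub>R S X + b *\<^sub>R S Y"
    and Ssym: "\<And>X Y. X \<in> g1 \<Longrightarrow> Y \<in> g1 \<Longrightarrow> S X \<bullet> Y = X \<bullet> S Y"
    and JJ: "\<And>V W X. V \<in> g2 \<Longrightarrow> W \<in> g2 \<Longrightarrow> X \<in> g1 \<Longrightarrow>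
        J_op br g1 V (J_op br g1 W X) + J_op br g1 W (J_op br g1 V X)
          = (- 2 * (V \<bullet> W)) *\<^sub>R S (S X)"
    using H unfolding generalized_H_type_def by blast+
  have lin1: "linear (br X)" and lin2: "linear (\<lambda>X. br X Y)" and alt: "br X X = 0" for X Y
    using carnot by (auto simp: step2_carnot_algebra_def lie_bracket_def)
  have brskew: "br X Y = - br Y X" for X Y
  proof -
    have "br (X + Y) (X + Y) = br X X + br X Y + (br Y X + br Y Y)"
      using linear_add[OF lin1] linear_add[OF lin2] by (simp add: algebra_simps)
    then have "br X Y + br Y X = 0" by (simp add: alt)
    then show ?thesis by (simp add: eq_neg_iff_add_eq_0)
  qed
  have sub1: "subspace g1" and sub2: "subspace g2"
    and mem: "e i \<in> g1" "f \<alpha> \<in> g2" and onf: "f \<alpha> \<bullet> f \<beta> = (if \<alpha> = \<beta> then 1 else 0)" for i \<alpha> \<beta>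
    using e f by (auto simp: orthonormal_basis_def span_base)
  note J = J_op_adjoint[of br, OF lin2 e]
  \<comment> \<open>The generalized H-type identity enters here, with V = W: it gives J_V^2 = -|V|^2
    S^2. Skewness of J_V and symmetry of \<open>S\<close> turn the two sides into squared
    norms.\<close>
  have Jnorm: "J_op br g1 V X \<bullet> J_op br g1 V X = (V \<bullet> V) * (S X \<bullet> S X)"
    if V: "V \<in> g2" and X: "X \<in> g1" for V X
  proof -
    let ?J = "J_op br g1 V"
    have "?J X \<bullet> ?J X = V \<bullet> br (?J X) X" using J X by blast
    also have "\<dots> = - (X \<bullet> ?J (?J X))" using J X brskew[of X] by simp
    also have "?J (?J X) = - ((V \<bullet> V) *\<^sub>R S (S X))"
    proof -
      have "2 *\<^sub>R ?J (?J X) = 2 *\<^sub>R (- ((V \<bullet> V) *\<^sub>R S (S X)))"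
        using JJ[OF V V X] by (simp add: scaleR_2)
      then show ?thesis by (simp only: scaleR_cancel_left) simp
    qed
    also have "X \<bullet> \<dots> = - ((V \<bullet> V) * (S X \<bullet> S X))"
      using Ssym[OF X Sg[OF X]] by simp
    finally show ?thesis by simp
  qed
  define E where "E x = (\<Sum>i\<in>UNIV. x $ i *\<^sub>R e i)" for x :: "real^'k"
  define F where "F v = (\<Sum>\<alpha>\<in>UNIV. v $ \<alpha> *\<^sub>R f \<alpha>)" for v :: "real^'m"
  have Eg: "E x \<in> g1" and Fg: "F v \<in> g2" for x v
    unfolding E_def F_def using sub1 sub2 mem by (auto intro!: subspace_sum subspace_scale)
  have Esurj: "\<exists>x. X = E x" if "X \<in> g1" for X
    using orthonormal_basis_expand[OF e that] 
    by (intro exI[of _ "\<chi> i. X \<bullet> e i"]) (simp add: E_def)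
  have FF: "F v \<bullet> F v = v \<bullet> v" for v
    by (simp add: F_def inner_sum_left inner_sum_right onf inner_vec_def if_distrib[where f = "(*) _"]
        sum.delta cong: if_cong)
  have form: "v \<bullet> bracket_form ?L x y = F v \<bullet> br (E x) (E y)" for v x y
  proof -
    have "br (E x) (E y) = (\<Sum>i\<in>UNIV. \<Sum>j\<in>UNIV. (x $ i * y $ j) *\<^sub>R br (e i) (e j))"
      unfolding E_def
      by (subst sum.swap) (simp add: linear_sum[OF lin1] linear_scale[OF lin1] linear_sum[OF lin2]
          linear_scale[OF lin2] scaleR_sum_right mult.commute)
    then have "bracket_form ?L x y $ \<alpha> = f \<alpha> \<bullet> br (E x) (E y)" for \<alpha>
      by (simp add: bracket_form_def structure_constants_def inner_sum_right inner_commute mult_ac)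
    then show ?thesis
      by (simp add: inner_vec_def F_def inner_sum_left)
  qed
  \<comment> \<open>\<open>S\<close> is linear on \<open>g1\<close> alone, so the sum is treated by
    induction, with every partial sum kept inside \<open>g1\<close>.\<close>
  have Ssum: "S (\<Sum>i\<in>A. x $ i *\<^sub>R e i) = (\<Sum>i\<in>A. x $ i *\<^sub>R S (e i))" if "finite A" for A and x :: "real^'k"
    using that
  proof induction
    case empty
    \<comment> \<open>S 0 = 0 is the linearity identity with both coefficients 0;
      \<open>e undefined\<close> is just some element of \<open>g1\<close>.\<close>
    show ?case using Slin[of "e undefined" "e undefined" 0 0] mem by simp
  next
    case (insert i A)
    have "(\<Sum>i\<in>A. x $ i *\<^sub>R e i) \<in> g1" using sub1 mem by (auto intro!: subspace_sum subspace_scale)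
    from Slin[OF mem(1) this, of "x $ i" i 1] show ?case using insert by simp
  qed
  have "(?M *v x) $ i = S (E x) \<bullet> e i" for x i
    by (simp add: operator_matrix_def matrix_vector_mult_def E_def Ssum inner_sum_right
        inner_commute[of _ "e i"] mult.commute)
  then have Mker: "?M *v x = 0 \<longleftrightarrow> S (E x) = 0" for x
    using orthonormal_basis_expand[OF e Sg[OF Eg], of x] by (auto simp: vec_eq_iff)
  show ?thesis
  proof
    fix x y :: "real^'k"
    have "v \<bullet> bracket_form ?L x y = v \<bullet> - bracket_form ?L y x" for v
      using brskew[of "E x"] by (simp add: form)
    then show "bracket_form ?L x y = - bracket_form ?L y x"
      using vector_eq_ldot by blast
  next
    fix x y :: "real^'k" assume "?M *v x = 0"
    then have "J_op br g1 (F v) (E x) = 0" for v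
      using Jnorm[OF Fg Eg, of v x] by (simp add: Mker)
    then have "v \<bullet> bracket_form ?L y x = v \<bullet> 0" for v
      using J(2)[OF Eg, of y "F v" "E x"] by (simp add: form)
    then show "bracket_form ?L y x = 0"
      using vector_eq_ldot by blast
  next
    fix v :: "real^'m" and x :: "real^'k"
    assume v: "v \<noteq> 0" and *: "\<And>y. v \<bullet> bracket_form ?L y x = 0"
    \<comment> \<open>The hypothesis is tested on the vector J_V X itself, with V =
      \<open>F v\<close> and X = \<open>E x\<close>, which makes its norm vanish.\<close>
    obtain y where "J_op br g1 (F v) (E x) = E y" using Esurj J(1) by blast
    then have "J_op br g1 (F v) (E x) \<bullet> J_op br g1 (F v) (E x) = 0"
      using J(2)[OF Eg, of y "F v" "E x"] *[of y] by (simp add: form)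
    then show "?M *v x = 0"
      using v unfolding Jnorm[OF Fg Eg] FF Mker by simp
  qed
qed

section \<open>Horizontal curves and the end-point map\<close>

lemma sum_frame:
  "(\<Sum>i\<in>UNIV. u $ i *\<^sub>R frame L i p) = (u, - (1/2) *\<^sub>R bracket_form L u (fst p))"
proof -
  have "fst (\<Sum>i\<in>UNIV. u $ i *\<^sub>R frame L i p) = u"
    by (simp add: fst_sum frame_def vec_eq_iff axis_def if_distrib[where f = "(*) _"] sum.delta
        cong: if_cong)
  moreover have "snd (\<Sum>i\<in>UNIV. u $ i *\<^sub>R frame L i p) = - (1/2) *\<^sub>R bracket_form L u (fst p)"
    by (simp add: snd_sum frame_def vec_eq_iff bracket_form_def sum_distrib_left sum_negf mult_ac)
  ultimately show ?thesis by (metis prod.collapse)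
qed

lemma inner_frame:
  fixes L :: "'m::finite \<Rightarrow> 'k::finite \<Rightarrow> 'k \<Rightarrow> real"
  shows "q \<bullet> frame L i p = fst q $ i - 1/2 * (snd q \<bullet> bracket_form L (axis i 1) (fst p))"
proof -
  \<comment> \<open>A single frame field is the velocity belonging to the constant control
    \<open>axis i 1\<close>, so \<open>sum_frame\<close> applies.\<close>
  have "(\<Sum>k\<in>UNIV. axis i 1 $ k *\<^sub>R frame L k p) = frame L i p"
    by (simp add: axis_def if_distrib[where f = "\<lambda>c. c *\<^sub>R _"] sum.delta cong: if_cong)
  then have "frame L i p = (axis i 1, - (1/2) *\<^sub>R bracket_form L (axis i 1) (fst p))"
    by (simp add: sum_frame)
  then show ?thesis by (simp add: inner_prod_def inner_axis)
qed

text \<open>The control system is triangular: the right-hand side involves the curve only through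
  its first component, which is a primitive of \<open>u\<close>. In the backward direction that
  component is therefore treated first; being Lipschitz, it makes the integrand of the second one
  essentially bounded.\<close>

lemma horizontal_curve_iff_integral:
  assumes "a \<le> b"
  shows "horizontal_curve L a b u \<gamma> \<longleftrightarrow> ess_bounded a b u \<and>
    (\<forall>t\<in>{a..b}. \<gamma> t = \<gamma> a + (integral {a..t} u,
        - (1/2) *\<^sub>R integral {a..t} (\<lambda>s. bracket_form L (u s) (fst (\<gamma> s)))))"
    (is "_ \<longleftrightarrow> _ \<and> ?I")
proof
  let ?g = "\<lambda>t. (u t, - (1/2) *\<^sub>R bracket_form L (u t) (fst (\<gamma> t)))"
  assume "horizontal_curve L a b u \<gamma>"
  then have u: "ess_bounded a b u" and lip: "\<exists>C. C-lipschitz_on {a..b} \<gamma>"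
    and der: "AE t in lebesgue_on {a..b}. (\<gamma> has_vector_derivative ?g t) (at t within {a..b})"
    by (auto simp: horizontal_curve_def Linf_iff_ess_bounded sum_frame)
  show "ess_bounded a b u \<and> ?I"
  proof (intro conjI ballI)
    fix t assume "t \<in> {a..b}"
    from has_integral_lipschitz_derivative_AE_subinterval[OF lip der this]
    have I: "(?g has_integral (\<gamma> t - \<gamma> a)) {a..t}" .
    have "integral {a..t} u = fst (\<gamma> t - \<gamma> a)"
      using has_integral_linear[OF I bounded_linear_fst] by (intro integral_unique) (simp add: o_def)
    moreover have "integral {a..t} (\<lambda>s. bracket_form L (u s) (fst (\<gamma> s))) = (-2) *\<^sub>R snd (\<gamma> t - \<gamma> a)"
      using has_integral_cmul[OF has_integral_linear[OF I bounded_linear_snd], of "-2"]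
      by (intro integral_unique) (simp add: o_def)
    ultimately show "\<gamma> t = \<gamma> a + (integral {a..t} u,
        - (1/2) *\<^sub>R integral {a..t} (\<lambda>s. bracket_form L (u s) (fst (\<gamma> s))))"
      by (simp add: prod_eq_iff)
  qed (fact u)
next
  assume "ess_bounded a b u \<and> ?I"
  then have u: "ess_bounded a b u" and I: ?I by blast+
  let ?h = "\<lambda>s. - (1/2) *\<^sub>R bracket_form L (u s) (fst (\<gamma> s))"
  have x: "fst (\<gamma> t) = fst (\<gamma> a) + integral {a..t} u" if "t \<in> {a..b}" for t
    using arg_cong[OF bspec[OF I that], of fst] by simp
  have X: "\<exists>C. C-lipschitz_on {a..b} (\<lambda>t. fst (\<gamma> t))"
    "AE t in lebesgue_on {a..b}. ((\<lambda>t. fst (\<gamma> t)) has_vector_derivative u t) (at t within {a..b})"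
    by (rule integral_curve_derivative_AE[OF u x]; assumption)+
  have "ess_bounded a b (\<lambda>t. fst (\<gamma> t))"
    using X(1) continuous_on_imp_ess_bounded[OF lipschitz_on_continuous_on] by blast
  from ess_bounded_scaleR[OF ess_bounded_bilinear[OF bounded_bilinear_bracket_form u this]]
  have h: "ess_bounded a b ?h" .
  have z: "snd (\<gamma> t) = snd (\<gamma> a) + integral {a..t} ?h" if "t \<in> {a..b}" for t
    using arg_cong[OF bspec[OF I that], of snd] by (simp only: integral_cmul snd_add snd_conv)
  have Z: "\<exists>C. C-lipschitz_on {a..b} (\<lambda>t. snd (\<gamma> t))"
    "AE t in lebesgue_on {a..b}. ((\<lambda>t. snd (\<gamma> t)) has_vector_derivative ?h t) (at t within {a..b})"
    by (rule integral_curve_derivative_AE[OF h z]; assumption)+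
  obtain C D where "C-lipschitz_on {a..b} (\<lambda>t. fst (\<gamma> t))" "D-lipschitz_on {a..b} (\<lambda>t. snd (\<gamma> t))"
    using X(1) Z(1) by blast
  from lipschitz_on_Pair[OF this] have "\<exists>C. C-lipschitz_on {a..b} \<gamma>" by auto
  moreover from X(2) Z(2) have
    "AE t in lebesgue_on {a..b}. (\<gamma> has_vector_derivative (u t, ?h t)) (at t within {a..b})"
  proof eventually_elim
    case (elim t)
    from has_vector_derivative_Pair[OF this] show ?case by simp
  qed
  ultimately show "horizontal_curve L a b u \<gamma>"
    using u by (simp add: horizontal_curve_def Linf_iff_ess_bounded sum_frame)
qed

text \<open>Resolves the \<open>THE\<close> in \<open>endpoint\<close>: by triangularity both
  existence and uniqueness of the curve come from successive integration.\<close>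

lemma endpoint_eq:
  fixes L :: "'m::finite \<Rightarrow> 'k::finite \<Rightarrow> 'k \<Rightarrow> real"
  assumes u: "ess_bounded 0 1 u"
  shows "endpoint L u =
    (integral {0..1} u, - (1/2) *\<^sub>R integral {0..1} (\<lambda>s. bracket_form L (u s) (integral {0..s} u)))"
proof -
  let ?B = "\<lambda>t. integral {0..t} (\<lambda>s. bracket_form L (u s) (integral {0..s} u))"
  let ?\<gamma> = "\<lambda>t. (integral {0..t} u, - (1/2) *\<^sub>R ?B t)"
  have eq: "\<gamma> 1 = ?\<gamma> 1" if "horizontal_curve L 0 1 u \<gamma>" "\<gamma> 0 = 0" for \<gamma>
  proof -
    have I: "\<gamma> t = (integral {0..t} u,
        - (1/2) *\<^sub>R integral {0..t} (\<lambda>s. bracket_form L (u s) (fst (\<gamma> s))))" if "t \<in> {0..1}" for t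
    proof -
      have "\<gamma> t = \<gamma> 0 + (integral {0..t} u,
          - (1/2) *\<^sub>R integral {0..t} (\<lambda>s. bracket_form L (u s) (fst (\<gamma> s))))"
        using iffD1[OF horizontal_curve_iff_integral[OF zero_le_one] \<open>horizontal_curve L 0 1 u \<gamma>\<close>] that
        by blast
      then show ?thesis by (simp only: \<open>\<gamma> 0 = 0\<close> add_0)
    qed
    have x: "fst (\<gamma> t) = integral {0..t} u" if "t \<in> {0..1}" for t
      by (subst I[OF that]) simp
    have "integral {0..1} (\<lambda>s. bracket_form L (u s) (fst (\<gamma> s))) = ?B 1"
      by (intro integral_cong) (simp only: x)
    then show ?thesis using I[of 1] by simp
  qed
  have "horizontal_curve L 0 1 u ?\<gamma>"
    using u by (simp add: horizontal_curve_iff_integral zero_prod_def[symmetric])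
  moreover have "?\<gamma> 0 = 0" by (simp add: zero_prod_def)
  ultimately have "endpoint L u = ?\<gamma> 1"
    unfolding endpoint_def using eq by (intro the_equality) blast+
  then show ?thesis by simp
qed

text \<open>A Frechet derivative must agree with the directional one. This identifies the
  unspecified \<open>D\<close> of \<open>abnormal_curve\<close> in a direction along which the map
  is a quadratic polynomial.\<close>

lemma Linf_has_derivative_along_line:
  assumes D: "Linf_has_derivative F D u" and w: "w \<in> Linf 0 1"
    and expand: "\<And>s. F (\<lambda>t. u t + s *\<^sub>R w t) = F u + s *\<^sub>R d + s\<^sup>2 *\<^sub>R q"
  shows "D w = d"
proof (rule ccontr)
  assume "D w \<noteq> d"
  define n where "n = norm (d - D w)"
  have "n > 0" using \<open>D w \<noteq> d\<close> by (simp add: n_def)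
  define K where "K = Linf_norm 0 1 w"
  have K: "K \<ge> 0" using esssup_norm_eq_Linf_norm(2)[OF w] by (simp add: K_def)
  \<comment> \<open>Makes \<open>\<epsilon> * K \<le> n / 3\<close>; the \<open>+ 1\<close> covers
    the case \<open>K = 0\<close>.\<close>
  define \<epsilon> where "\<epsilon> = n / (3 * (K + 1))"
  have "\<epsilon> > 0" using \<open>n > 0\<close> K by (simp add: \<epsilon>_def)
  then obtain \<delta> where \<delta>: "\<delta> > 0" "\<And>w. w \<in> Linf 0 1 \<Longrightarrow> Linf_norm 0 1 w < \<delta> \<Longrightarrow>
        norm (F (\<lambda>t. u t + w t) - F u - D w) \<le> \<epsilon> * Linf_norm 0 1 w"
    using D unfolding Linf_has_derivative_def by meson
  \<comment> \<open>The first bound brings the norm of \<open>s *\<^sub>R w\<close> below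
    \<open>\<delta>\<close>, the second gives \<open>norm (s *\<^sub>R q) \<le> n / 3\<close>. Two
    thirds of \<open>n\<close> cannot dominate \<open>n\<close>.\<close>
  define s where "s = min (\<delta> / (2 * (K + 1))) (n / (3 * (norm q + 1)))"
  have s: "s > 0" using \<open>n > 0\<close> K \<delta>(1) by (auto simp: s_def intro!: divide_pos_pos add_nonneg_pos)
  have sw: "(\<lambda>t. s *\<^sub>R w t) \<in> Linf 0 1" using w by (simp add: Linf_iff_ess_bounded ess_bounded_scaleR)
  have sK: "Linf_norm 0 1 (\<lambda>t. s *\<^sub>R w t) \<le> s * K"
    using Linf_norm_scaleR_le[OF w, of s] s by (simp add: K_def)
  also have "\<dots> \<le> \<delta> / (2 * (K + 1)) * K" using K by (intro mult_right_mono) (auto simp: s_def)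
  also have "\<dots> < \<delta>" using K \<delta>(1) by (simp add: field_simps add_nonneg_pos)
  finally have "norm (F (\<lambda>t. u t + s *\<^sub>R w t) - F u - D (\<lambda>t. s *\<^sub>R w t)) \<le> \<epsilon> * Linf_norm 0 1 (\<lambda>t. s *\<^sub>R w t)"
    by (rule \<delta>(2)[OF sw])
  also have "\<dots> \<le> \<epsilon> * (s * K)" using sK \<open>\<epsilon> > 0\<close> by simp
  also have "D (\<lambda>t. s *\<^sub>R w t) = s *\<^sub>R D w"
  proof -
    have "D (\<lambda>t. s *\<^sub>R w t + 0 *\<^sub>R w t) = s *\<^sub>R D w + 0 *\<^sub>R D w"
      using D w unfolding Linf_has_derivative_def by blast
    then show ?thesis by simp
  qed
  also have "F (\<lambda>t. u t + s *\<^sub>R w t) - F u - s *\<^sub>R D w = s *\<^sub>R (d - D w + s *\<^sub>R q)"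
    by (simp add: expand algebra_simps power2_eq_square)
  finally have "s * norm (d - D w + s *\<^sub>R q) \<le> s * (\<epsilon> * K)"
    using s by (simp add: mult_ac)
  then have "norm (d - D w + s *\<^sub>R q) \<le> \<epsilon> * K" using s by simp
  moreover have "n \<le> norm (d - D w + s *\<^sub>R q) + norm (s *\<^sub>R q)"
    unfolding n_def by (metis add_diff_cancel norm_triangle_ineq4)
  moreover have "norm (s *\<^sub>R q) \<le> n / 3"
  proof -
    have "norm (s *\<^sub>R q) = s * norm q" using s by simp
    also have "\<dots> \<le> n / (3 * (norm q + 1)) * norm q"
      by (intro mult_right_mono) (simp_all add: s_def)
    also have "\<dots> \<le> n / (3 * (norm q + 1)) * (norm q + 1)"
      using \<open>n > 0\<close> by (intro mult_left_mono) auto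
    also have "\<dots> = n / 3"
    proof -
      have "norm q + 1 \<noteq> 0" using norm_ge_zero[of q] by linarith
      moreover have "n / (3 * c) * c = n / 3" if "c \<noteq> 0" for c using that by simp
      ultimately show ?thesis by blast
    qed
    finally show ?thesis .
  qed
  moreover have "\<epsilon> * K \<le> n / 3" using K \<open>n > 0\<close> by (simp add: \<epsilon>_def field_simps)
  ultimately show False using \<open>n > 0\<close> by simp
qed

lemmas ess_bounded_bracket_form = ess_bounded_bilinear[OF bounded_bilinear_bracket_form]

text \<open>The end-point is linear in the control in its first component and quadratic in the
  second, so the expansion along a line is exact. The coefficient of \<open>s\<close> is the
  differential, the one of \<open>s\<^sup>2\<close> the whole remainder.\<close>

lemma endpoint_expansion:
  fixes L :: "'m::finite \<Rightarrow> 'k::finite \<Rightarrow> 'k \<Rightarrow> real"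
  assumes u: "ess_bounded 0 1 u" and w: "ess_bounded 0 1 w"
  defines "x \<equiv> \<lambda>t. integral {0..t} u" and "y \<equiv> \<lambda>t. integral {0..t} w"
  shows "endpoint L (\<lambda>t. u t + s *\<^sub>R w t) = endpoint L u +
      s *\<^sub>R (integral {0..1} w,
        - (1/2) *\<^sub>R integral {0..1} (\<lambda>t. bracket_form L (w t) (x t) + bracket_form L (u t) (y t))) +
      s\<^sup>2 *\<^sub>R (0, - (1/2) *\<^sub>R integral {0..1} (\<lambda>t. bracket_form L (w t) (y t)))"
proof -
  interpret B: bounded_bilinear "bracket_form L" by (rule bounded_bilinear_bracket_form)
  have x: "ess_bounded 0 1 x" and y: "ess_bounded 0 1 y"
    unfolding x_def y_def by (intro ess_bounded_integral u w)+
  note I = ess_bounded_integrable[OF ess_bounded_bracket_form]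
  have usw: "ess_bounded 0 1 (\<lambda>t. u t + s *\<^sub>R w t)"
    by (intro ess_bounded_add ess_bounded_scaleR u w)
  have "integral {0..1} (\<lambda>t. bracket_form L (u t + s *\<^sub>R w t) (integral {0..t} (\<lambda>t. u t + s *\<^sub>R w t)))
    = integral {0..1} (\<lambda>t. bracket_form L (u t) (x t)
         + s *\<^sub>R (bracket_form L (w t) (x t) + bracket_form L (u t) (y t))
         + s\<^sup>2 *\<^sub>R bracket_form L (w t) (y t))"
  proof (rule integral_cong)
    fix t :: real assume t: "t \<in> {0..1}"
    show "bracket_form L (u t + s *\<^sub>R w t) (integral {0..t} (\<lambda>t. u t + s *\<^sub>R w t))
      = bracket_form L (u t) (x t)
         + s *\<^sub>R (bracket_form L (w t) (x t) + bracket_form L (u t) (y t))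
         + s\<^sup>2 *\<^sub>R bracket_form L (w t) (y t)"
      unfolding integral_add_scaleR[OF u w t]
      by (simp add: x_def y_def B.add_left B.add_right B.scaleR_left B.scaleR_right algebra_simps power2_eq_square)
  qed
  also have "\<dots> = integral {0..1} (\<lambda>t. bracket_form L (u t) (x t))
       + s *\<^sub>R integral {0..1} (\<lambda>t. bracket_form L (w t) (x t) + bracket_form L (u t) (y t))
       + s\<^sup>2 *\<^sub>R integral {0..1} (\<lambda>t. bracket_form L (w t) (y t))"
    by (rule integral_unique)
      (intro has_integral_add has_integral_cmul integrable_integral integrable_add I u w x y)
  finally show ?thesis
    using integral_add_scaleR[OF u w, of 1 s]
    unfolding endpoint_eq[OF usw] endpoint_eq[OF u] x_def y_def
    by (simp add: algebra_simps)
qed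

section \<open>Critical points of the end-point map\<close>

context kernel_form begin

lemma kernel_left: "M *v x = 0 \<Longrightarrow> bracket_form L x y = 0"
  using skew[of x y] kernel[of x y] by simp

text \<open>The annihilation condition is tested on a single variation: \<open>g\<close>, the
  density of the functional sending \<open>w\<close> to \<open>\<xi> \<bullet> D w\<close>. This
  yields a vanishing integral of |g|^2, and continuity makes \<open>g\<close> zero at every time, so
  that it may be evaluated at 0.\<close>

lemma abnormal_imp_kernel_control:
  assumes u: "ess_bounded 0 1 u" and D: "Linf_has_derivative (endpoint L) D u"
    and \<xi>: "\<xi> \<noteq> 0" "\<And>w. w \<in> Linf 0 1 \<Longrightarrow> \<xi> \<bullet> D w = 0"
  shows "AE t in lebesgue_on {0..1}. M *v u t = 0"
proof -
  interpret B: bounded_bilinear "bracket_form L" by (rule bounded_bilinear_bracket_form)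
  define x where "x t = integral {0..t} u" for t
  interpret K: bounded_linear "bracket_adjoint L (snd \<xi>)" by (rule bounded_linear_bracket_adjoint)
  define K where "K = bracket_adjoint L (snd \<xi>)"
  define g where "g t = fst \<xi> - K (x t) + (1/2) *\<^sub>R K (x 1)" for t
  have K: "snd \<xi> \<bullet> bracket_form L y p = y \<bullet> K p" for y p
    unfolding K_def by (rule inner_bracket_form)
  have x: "\<exists>C. C-lipschitz_on {0..1} x"
     "AE t in lebesgue_on {0..1}. (x has_vector_derivative u t) (at t within {0..1})"
    using integral_curve_derivative_AE[OF u, of x 0] by (auto simp: x_def)
  then have contx: "continuous_on {0..1} x" using lipschitz_on_continuous_on by blast
  then have contg: "continuous_on {0..1} g"
    unfolding g_def K_def by (auto intro!: continuous_intros K.continuous_on)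
  have xb: "ess_bounded 0 1 x" and g: "ess_bounded 0 1 g"
    using contx contg by (auto intro: continuous_on_imp_ess_bounded)
  define y where "y t = integral {0..t} g" for t
  have y: "ess_bounded 0 1 y" unfolding y_def by (rule ess_bounded_integral[OF g])
  let ?w = "\<lambda>t. bracket_form L (g t) (x t)" and ?u = "\<lambda>t. bracket_form L (u t) (y t)"
  have I: "?w integrable_on {0..1}" "?u integrable_on {0..1}" "g integrable_on {0..1}"
    by (intro ess_bounded_integrable ess_bounded_bracket_form u y g xb)+
  have "D g = (integral {0..1} g, - (1/2) *\<^sub>R integral {0..1} (\<lambda>t. ?w t + ?u t))"
    unfolding x_def y_def
    by (rule Linf_has_derivative_along_line[OF D _ endpoint_expansion[OF u g]])
      (simp add: Linf_iff_ess_bounded g)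
  \<comment> \<open>Integration by parts moves the primitive from the variation to the control; by
    skewness the result is a second copy of \<open>?w\<close> and a boundary term.\<close>
  also have "integral {0..1} (\<lambda>t. ?w t + ?u t) = 2 *\<^sub>R integral {0..1} ?w - bracket_form L (y 1) (x 1)"
  proof -
    have "((\<lambda>t. bracket_form L (x t) (g t) + ?u t) has_integral bracket_form L (x 1) (y 1)) {0..1}"
      using integral_by_parts_bilinear[OF bounded_bilinear_bracket_form, of 0 1 u g L] u g
      by (simp add: x_def y_def)
    then have "bracket_form L (x 1) (y 1) = integral {0..1} (\<lambda>t. ?u t - ?w t)"
      by (subst integral_unique[symmetric]) (auto simp: skew[of "x _"])
    then show ?thesis
      using I skew[of "x 1" "y 1"] by (simp add: integral_add integral_diff scaleR_2 algebra_simps)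
  qed
  finally have "\<xi> \<bullet> D g = fst \<xi> \<bullet> y 1 - snd \<xi> \<bullet> integral {0..1} ?w + 1/2 * (snd \<xi> \<bullet> bracket_form L (y 1) (x 1))"
    by (simp add: inner_prod_def y_def inner_diff_right algebra_simps)
  \<comment> \<open>Each of the three terms is the integral of \<open>g\<close> against one summand
    of the definition of \<open>g\<close>.\<close>
  also have "\<dots> = integral {0..1} (\<lambda>t. g t \<bullet> g t)"
  proof -
    have i1: "((\<lambda>t. g t \<bullet> fst \<xi>) has_integral y 1 \<bullet> fst \<xi>) {0..1}"
      using has_integral_linear[OF integrable_integral[OF I(3)] bounded_linear_inner_left] by (simp add: o_def y_def)
    have i2: "((\<lambda>t. snd \<xi> \<bullet> ?w t) has_integral snd \<xi> \<bullet> integral {0..1} ?w) {0..1}"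
      using has_integral_linear[OF integrable_integral[OF I(1)] bounded_linear_inner_right] by (simp add: o_def)
    have i3: "((\<lambda>t. g t \<bullet> K (x 1)) has_integral y 1 \<bullet> K (x 1)) {0..1}"
      using has_integral_linear[OF integrable_integral[OF I(3)] bounded_linear_inner_left] by (simp add: o_def y_def)
    have "((\<lambda>t. g t \<bullet> fst \<xi> - snd \<xi> \<bullet> ?w t + 1/2 * (g t \<bullet> K (x 1))) has_integral
       y 1 \<bullet> fst \<xi> - snd \<xi> \<bullet> integral {0..1} ?w + 1/2 * (y 1 \<bullet> K (x 1))) {0..1}"
      by (intro has_integral_add has_integral_diff has_integral_mult_right i1 i2 i3)
    moreover have "g t \<bullet> fst \<xi> - snd \<xi> \<bullet> ?w t + 1/2 * (g t \<bullet> K (x 1)) = g t \<bullet> g t" for t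
      unfolding K by (subst (5) g_def) (simp add: inner_add_right inner_diff_right)
    ultimately show ?thesis
      by (simp add: integral_unique K inner_commute)
  qed
  finally have "integral {0..1} (\<lambda>t. g t \<bullet> g t) = 0"
    using \<xi>(2)[of g] g by (simp add: Linf_iff_ess_bounded)
  moreover have "continuous_on {0..1} (\<lambda>t. g t \<bullet> g t)" using contg by (intro continuous_intros)
  ultimately have g0: "g t = 0" if "t \<in> {0..1}" for t
    using integral_eq_0_iff[of 0 1 "\<lambda>t. g t \<bullet> g t"] that by auto
  \<comment> \<open>The curve starts at the origin, so \<open>g 0 = 0\<close> eliminates the
    constant part of \<open>g\<close> and leaves \<open>g t = - K (x t)\<close>.\<close>
  have "K (x 0) = 0" by (simp add: x_def K_def K.zero)
  then have "fst \<xi> + (1/2) *\<^sub>R K (x 1) = 0"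
    using g0[of 0] by (simp add: g_def)
  then have Kx: "K (x t) = 0" if "t \<in> {0..1}" for t
    using g0[OF that] by (simp add: g_def algebra_simps)
  have "snd \<xi> \<noteq> 0"
  proof
    assume "snd \<xi> = 0"
    moreover from this have "K (x 1) = 0" by (simp add: K_def)
    then have "fst \<xi> = 0"
      using \<open>fst \<xi> + (1/2) *\<^sub>R K (x 1) = 0\<close> by simp
    ultimately show False using \<xi>(1) by (simp add: prod_eq_iff)
  qed
  then have Mx: "M *v x t = 0" if "t \<in> {0..1}" for t
    using nondegenerate[of "snd \<xi>" "x t"] K[of _ "x t"] Kx[OF that] by simp
  \<comment> \<open>\<open>M *v x t\<close> vanishes identically, while its derivative is
    \<open>M *v u t\<close> almost everywhere. Membership of \<open>t\<close> in the interval is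
    recorded for uniqueness of the derivative within it.\<close>
  have "AE t in lebesgue_on {0..1}. t \<in> {0..1::real}"
    by (rule AE_I2) simp
  with x(2) show ?thesis
  proof eventually_elim
    case (elim t)
    have "((\<lambda>t. M *v x t) has_vector_derivative M *v u t) (at t within {0..1})"
      using bounded_linear.has_vector_derivative[OF matrix_vector_mul_bounded_linear elim(1)] .
    moreover have "((\<lambda>t. M *v x t) has_vector_derivative 0) (at t within {0..1})"
      using elim(2) Mx by (intro has_vector_derivative_transform[OF _ _ has_vector_derivative_const[of 0]]) auto
    ultimately show ?case
      using vector_derivative_unique_within_closed_interval[of 0 1 t] elim(2) by auto
  qed
qed

lemma integral_in_kernel:
  assumes u: "ess_bounded a b u" and ker: "AE t in lebesgue_on {a..b}. M *v u t = 0" and "t \<in> {a..b}"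
  shows "M *v integral {a..t} u = 0"
proof -
  have "ess_bounded a b (\<lambda>t. M *v u t)"
    by (rule ess_bounded_linear[OF matrix_vector_mul_bounded_linear u])
  from norm_integral_le_AE[OF this, of 0 t] have "norm (integral {a..t} (\<lambda>t. M *v u t)) \<le> 0"
    using ker \<open>t \<in> {a..b}\<close> by simp
  moreover have "u integrable_on {a..t}"
    using ess_bounded_integrable[OF u] by (rule integrable_on_subinterval) (use \<open>t \<in> {a..b}\<close> in auto)
  ultimately show ?thesis
    using integral_linear[OF _ matrix_vector_mul_bounded_linear, of u "{a..t}" M] by (simp add: o_def)
qed

text \<open>Both first-order bracket terms have a factor in the kernel, either \<open>u\<close> or
  its primitive. What remains beyond the linear part is the quadratic term of the expansion, of
  order \<open>K\<close> times the squared norm of \<open>w\<close>.\<close>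

lemma kernel_control_endpoint_derivative:
  assumes u: "ess_bounded 0 1 u" and ker: "AE t in lebesgue_on {0..1}. M *v u t = 0"
  shows "Linf_has_derivative (endpoint L) (\<lambda>w. (integral {0..1} w, 0)) u"
  unfolding Linf_has_derivative_def
proof (intro conjI ballI allI impI)
  fix v w :: "real \<Rightarrow> real^'k" and a b :: real
  assume "v \<in> Linf 0 1" "w \<in> Linf 0 1"
  then have "v integrable_on {0..1}" "w integrable_on {0..1}"
    by (auto simp: Linf_iff_ess_bounded ess_bounded_integrable)
  then have "integral {0..1} (\<lambda>t. a *\<^sub>R v t + b *\<^sub>R w t) = a *\<^sub>R integral {0..1} v + b *\<^sub>R integral {0..1} w"
    by (subst integral_add) (auto intro: integrable_cmul)
  then show "((integral {0..1} (\<lambda>t. a *\<^sub>R v t + b *\<^sub>R w t), 0) :: ('k, 'm) point) =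
      a *\<^sub>R (integral {0..1} v, 0) + b *\<^sub>R (integral {0..1} w, 0)" by simp
next
  have "norm (integral {0..1} w) \<le> Linf_norm 0 1 w" if w: "w \<in> Linf 0 1" for w :: "real \<Rightarrow> real^'k"
    using norm_integral_le_AE[of 0 1 w "Linf_norm 0 1 w" 1] AE_le_Linf_norm[OF w] esssup_norm_eq_Linf_norm(2)[OF w] w
    by (auto simp: Linf_iff_ess_bounded)
  then show "\<exists>K. \<forall>w\<in>Linf 0 1. norm ((integral {0..1} w, 0) :: ('k, 'm) point) \<le> K * Linf_norm 0 1 w"
    by (intro exI[of _ 1]) auto
next
  interpret B: bounded_bilinear "bracket_form L" by (rule bounded_bilinear_bracket_form)
  obtain K where K: "K > 0" "\<And>x y. norm (bracket_form L x y) \<le> norm x * norm y * K"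
    using B.pos_bounded by auto
  fix \<epsilon> :: real assume "\<epsilon> > 0"
  have "norm (endpoint L (\<lambda>t. u t + w t) - endpoint L u - (integral {0..1} w, 0)) \<le> \<epsilon> * Linf_norm 0 1 w"
    if w: "w \<in> Linf 0 1" and small: "Linf_norm 0 1 w < \<epsilon> / K" for w
  proof -
    let ?n = "Linf_norm 0 1 w"
    have wb: "ess_bounded 0 1 w" and n: "AE t in lebesgue_on {0..1}. norm (w t) \<le> ?n" "?n \<ge> 0"
      using w AE_le_Linf_norm[OF w] esssup_norm_eq_Linf_norm(2)[OF w] by (auto simp: Linf_iff_ess_bounded)
    define y where "y t = integral {0..t} w" for t
    have yb: "ess_bounded 0 1 y" unfolding y_def by (rule ess_bounded_integral[OF wb])
    have yn: "norm (y t) \<le> ?n" if "t \<in> {0..1}" for t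
    proof -
      have "norm (y t) \<le> ?n * (t - 0)"
        unfolding y_def by (rule norm_integral_le_AE[OF wb n that])
      also have "\<dots> \<le> ?n" using that n(2) by (auto intro: mult_left_le)
      finally show ?thesis .
    qed
    have "integral {0..1} (\<lambda>t. bracket_form L (w t) (integral {0..t} u) + bracket_form L (u t) (y t))
        = integral {0..1::real} (\<lambda>t. 0)"
    proof (rule integral_cong_AE_lebesgue_on)
      have "AE t in lebesgue_on {0..1}. t \<in> {0..1::real}"
        by (rule AE_I2) simp
      with ker show "AE t in lebesgue_on {0..1}.
          bracket_form L (w t) (integral {0..t} u) + bracket_form L (u t) (y t) = 0"
        by eventually_elim (simp add: kernel_left kernel integral_in_kernel[OF u ker])
    qed
    then have "endpoint L (\<lambda>t. u t + w t) - endpoint L u - (integral {0..1} w, 0)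
        = (0, - (1/2) *\<^sub>R integral {0..1} (\<lambda>t. bracket_form L (w t) (y t)))"
      using endpoint_expansion[OF u wb, of L 1] by (simp add: y_def)
    then have "norm (endpoint L (\<lambda>t. u t + w t) - endpoint L u - (integral {0..1} w, 0))
        \<le> norm (integral {0..1} (\<lambda>t. bracket_form L (w t) (y t)))"
      by simp
    also have "\<dots> \<le> (?n * ?n * K) * (1 - 0)"
    proof (rule norm_integral_le_AE[OF ess_bounded_bracket_form[OF wb yb]])
      have "AE t in lebesgue_on {0..1}. t \<in> {0..1::real}"
        by (rule AE_I2) simp
      with n(1) show "AE t in lebesgue_on {0..1}. norm (bracket_form L (w t) (y t)) \<le> ?n * ?n * K"
      proof eventually_elim
        case (elim t)
        have "norm (w t) * norm (y t) * K \<le> ?n * ?n * K"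
          using elim yn n(2) K(1) by (intro mult_right_mono mult_mono) auto
        then show ?case using K(2) order_trans by blast
      qed
    qed (use n K in auto)
    \<comment> \<open>The threshold \<open>\<epsilon> / K\<close> on the norm is chosen for this
      inequality.\<close>
    also have "\<dots> \<le> \<epsilon> * ?n"
      using small K(1) n(2) mult_right_mono[of "?n * K" \<epsilon> ?n] by (simp add: field_simps)
    finally show ?thesis .
  qed
  then show "\<exists>\<delta>>0. \<forall>w\<in>Linf 0 1. Linf_norm 0 1 w < \<delta> \<longrightarrow>
      norm (endpoint L (\<lambda>t. u t + w t) - endpoint L u - (integral {0..1} w, 0)) \<le> \<epsilon> * Linf_norm 0 1 w"
    using \<open>\<epsilon> > 0\<close> K(1) by (intro exI[of _ "\<epsilon> / K"]) auto
qed

lemma abnormal_curve_iff: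
  "abnormal_curve L \<gamma> \<longleftrightarrow>
    (\<exists>u. horizontal_curve L 0 1 u \<gamma> \<and> \<gamma> 0 = 0 \<and> (AE t in lebesgue_on {0..1}. M *v u t = 0))"
proof
  assume "abnormal_curve L \<gamma>"
  then obtain u D \<xi> where u: "horizontal_curve L 0 1 u \<gamma>" "\<gamma> 0 = 0"
    and "Linf_has_derivative (endpoint L) D u" "\<xi> \<noteq> 0" "\<And>w. w \<in> Linf 0 1 \<Longrightarrow> \<xi> \<bullet> D w = 0"
    unfolding abnormal_curve_def by blast
  moreover have "ess_bounded 0 1 u" using u by (auto simp: horizontal_curve_def Linf_iff_ess_bounded)
  ultimately show "\<exists>u. horizontal_curve L 0 1 u \<gamma> \<and> \<gamma> 0 = 0 \<and> (AE t in lebesgue_on {0..1}. M *v u t = 0)"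
    using abnormal_imp_kernel_control by blast
next
  assume "\<exists>u. horizontal_curve L 0 1 u \<gamma> \<and> \<gamma> 0 = 0 \<and> (AE t in lebesgue_on {0..1}. M *v u t = 0)"
  then obtain u where u: "horizontal_curve L 0 1 u \<gamma>" "\<gamma> 0 = 0" "AE t in lebesgue_on {0..1}. M *v u t = 0"
    by blast
  then have "ess_bounded 0 1 u" by (auto simp: horizontal_curve_def Linf_iff_ess_bounded)
  then have D: "Linf_has_derivative (endpoint L) (\<lambda>w. (integral {0..1} w, 0)) u"
    using u(3) by (rule kernel_control_endpoint_derivative)
  have "\<exists>\<xi> :: ('k, 'm) covector. \<xi> \<noteq> 0 \<and> (\<forall>w\<in>Linf 0 1. \<xi> \<bullet> (integral {0..1} w, 0) = 0)"
    \<comment> \<open>The image of the differential has zero second component, so a covector along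
      dz annihilates it; \<open>undefined\<close> stands for some index.\<close>
    by (intro exI[of _ "(0, axis undefined 1)"]) (auto simp: zero_prod_def axis_eq_0_iff)
  then show "abnormal_curve L \<gamma>"
    unfolding abnormal_curve_def using u(1,2) D by blast
qed

end

section \<open>The Hamiltonian flow\<close>

lemma grad_eqI:
  assumes "GDERIV h x :> d"
  shows "grad h x = d"
  unfolding grad_def
proof (rule the_equality[of "\<lambda>d. GDERIV h x :> d"])
  fix d' assume "GDERIV h x :> d'"
  with assms have "(\<lambda>y. y \<bullet> d') = (\<lambda>y. y \<bullet> d)"
    unfolding gderiv_def by (rule has_derivative_unique[rotated])
  then have "y \<bullet> d' = y \<bullet> d" for y by (rule fun_cong)
  then show "d' = d" using vector_eq_ldot by blast
qed (fact assms)

lemma constant_of_zero_vector_derivative: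
  assumes "\<And>t. t \<in> {a..b} \<Longrightarrow> (f has_vector_derivative 0) (at t within {a..b})" "t \<in> {a..b}"
  shows "f t = f a"
  using has_derivative_zero_constant[of "{a..b}" f] assms
  by (fastforce simp: has_vector_derivative_def)

text \<open>The components of \<open>h\<close> are the momenta
  \<open>q \<bullet> frame L i p\<close>, so the Hamiltonian is |h|^2 / 2. Its gradient in the
  covector is the velocity with control \<open>h\<close>.\<close>

lemma hamiltonian_field_eq:
  fixes L :: "'m::finite \<Rightarrow> 'k::finite \<Rightarrow> 'k \<Rightarrow> real" and p q :: "(real^'k) \<times> (real^'m)"
  assumes skew: "\<And>x y. bracket_form L x y = - bracket_form L y x"
  defines "h \<equiv> fst q - (1/2) *\<^sub>R bracket_adjoint L (snd q) (fst p)"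
  shows "hamiltonian_field (hamiltonian L) (p, q) =
    ((h, - (1/2) *\<^sub>R bracket_form L h (fst p)), (- (1/2) *\<^sub>R bracket_adjoint L (snd q) h, 0))"
proof -
  interpret B: bounded_bilinear "bracket_form L" by (rule bounded_bilinear_bracket_form)
  have h: "q \<bullet> frame L i p = h $ i" for i
    by (simp add: inner_frame h_def bracket_adjoint_def)
  have half_squares: "((\<lambda>y. 1/2 * (\<Sum>i\<in>UNIV. (F i y)\<^sup>2)) has_derivative
      (\<lambda>d. \<Sum>i\<in>UNIV. F i y * F' i d)) (at y)"
    if "\<And>i. (F i has_derivative F' i) (at y)"
    for F F' :: "'k \<Rightarrow> (real^'k) \<times> (real^'m) \<Rightarrow> real" and y
    by (auto intro!: derivative_eq_intros that simp: sum_distrib_left mult_ac)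
  have "GDERIV (\<lambda>q'. hamiltonian L (p, q')) q :> (\<Sum>i\<in>UNIV. h $ i *\<^sub>R frame L i p)"
    using half_squares[of "\<lambda>i q'. q' \<bullet> frame L i p" "\<lambda>i d. d \<bullet> frame L i p" q]
    by (simp add: gderiv_def hamiltonian_def h inner_sum_right bounded_linear_inner_left
        bounded_linear_imp_has_derivative)
  moreover have "GDERIV (\<lambda>p'. hamiltonian L (p', q)) p :> ((1/2) *\<^sub>R bracket_adjoint L (snd q) h, 0)"
  proof -
    have "((\<lambda>p'. q \<bullet> frame L i p') has_derivative
        (\<lambda>d. - (1/2) * (snd q \<bullet> bracket_form L (axis i 1) (fst d)))) (at p)" for i
      unfolding inner_frame
      by (auto intro!: derivative_eq_intros B.bounded_linear_right[THEN bounded_linear.has_derivative])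
    from half_squares[OF this] have "((\<lambda>p'. hamiltonian L (p', q)) has_derivative
        (\<lambda>d. \<Sum>i\<in>UNIV. h $ i * (- (1/2) * (snd q \<bullet> bracket_form L (axis i 1) (fst d))))) (at p)"
      by (simp only: hamiltonian_def h prod.case)
    also have "(\<lambda>d. \<Sum>i\<in>UNIV. h $ i * (- (1/2) * (snd q \<bullet> bracket_form L (axis i 1) (fst d))))
      = (\<lambda>d::(real^'k) \<times> (real^'m). d \<bullet> ((1/2) *\<^sub>R bracket_adjoint L (snd q) h, 0))"
    proof
      fix d :: "(real^'k) \<times> (real^'m)"
      have "(\<Sum>i\<in>UNIV. h $ i * (- (1/2) * (snd q \<bullet> bracket_form L (axis i 1) (fst d))))
          = - (1/2) * (h \<bullet> bracket_adjoint L (snd q) (fst d))"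
        by (simp add: inner_vec_def bracket_adjoint_def sum_distrib_left sum_negf mult_ac)
      \<comment> \<open>Moving the skew operator from \<open>fst d\<close> to \<open>h\<close>
        changes the sign.\<close>
      also have "\<dots> = (1/2) * (fst d \<bullet> bracket_adjoint L (snd q) h)"
        unfolding inner_bracket_form[symmetric] using skew[of h "fst d"] by simp
      finally show "(\<Sum>i\<in>UNIV. h $ i * (- (1/2) * (snd q \<bullet> bracket_form L (axis i 1) (fst d))))
          = d \<bullet> ((1/2) *\<^sub>R bracket_adjoint L (snd q) h, 0)"
        by (simp add: inner_prod_def)
    qed
    finally show ?thesis by (simp only: gderiv_def)
  qed
  ultimately show ?thesis
    by (simp add: hamiltonian_field_def grad_eqI sum_frame)
qed

section \<open>Normal geodesics with initial covector in the kernel\<close>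

context kernel_form begin

text \<open>The straight line solves the Hamiltonian system since all brackets with \<open>u\<close>
  vanish. Uniqueness of the end point rests on a conserved norm: the skew operator J_v drives h - u,
  which starts at 0.\<close>

lemma exp_e_kernel:
  assumes Mu: "M *v u = 0"
  shows "exp_e L (u, v) = (u, 0)"
  unfolding exp_e_def
proof (rule the_equality)
  interpret B: bounded_bilinear "bracket_form L" by (rule bounded_bilinear_bracket_form)
  interpret K: bounded_linear "bracket_adjoint L v" by (rule bounded_linear_bracket_adjoint)
  have Ku: "bracket_adjoint L v u = 0"
    by (simp add: bracket_adjoint_def kernel[OF Mu] vec_eq_iff)
  let ?X = "hamiltonian_field (hamiltonian L)"
  note X = hamiltonian_field_eq[of L, OF skew]
  show "\<exists>c. (\<forall>t\<in>{0..1}. (c has_vector_derivative ?X (c t)) (at t within {0..1})) \<and>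
      c 0 = (0, u, v) \<and> fst (c 1) = (u, 0)"
  proof (intro exI conjI ballI)
    let ?c = "\<lambda>t::real. ((t *\<^sub>R u, 0::real^'m), (u, v))"
    fix t :: real
    have "?X (?c t) = ((u, 0), (0, 0))"
      unfolding X by (simp add: K.scaleR Ku kernel_left[OF Mu])
    then show "(?c has_vector_derivative ?X (?c t)) (at t within {0..1})"
      by (auto intro!: derivative_eq_intros simp: zero_prod_def)
    show "?c 0 = (0, u, v)" "fst (?c 1) = (u, 0)" by (auto simp: zero_prod_def)
  qed
  fix p assume "\<exists>c. (\<forall>t\<in>{0..1}. (c has_vector_derivative ?X (c t)) (at t within {0..1})) \<and>
      c 0 = (0, u, v) \<and> fst (c 1) = p"
  then obtain c where c': "\<And>t. t \<in> {0..1} \<Longrightarrow> (c has_vector_derivative ?X (c t)) (at t within {0..1})"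
    and c0: "c 0 = (0, u, v)" and p: "fst (c 1) = p" by blast
  define x z q1 q2 where "x t = fst (fst (c t))" and "z t = snd (fst (c t))"
    and "q1 t = fst (snd (c t))" and "q2 t = snd (snd (c t))" for t
  define h where "h t = q1 t - (1/2) *\<^sub>R bracket_adjoint L (q2 t) (x t)" for t
  have Xc: "?X (c t) = ((h t, - (1/2) *\<^sub>R bracket_form L (h t) (x t)),
      (- (1/2) *\<^sub>R bracket_adjoint L (q2 t) (h t), 0))" for t
    using X[of "fst (c t)" "snd (c t)"] by (simp add: h_def x_def q1_def q2_def)
  note fs = bounded_linear.has_vector_derivative[OF bounded_linear_fst]
    bounded_linear.has_vector_derivative[OF bounded_linear_snd]
  have x': "(x has_vector_derivative h t) (at t within {0..1})"
    and z': "(z has_vector_derivative - (1/2) *\<^sub>R bracket_form L (h t) (x t)) (at t within {0..1})"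
    and q1': "(q1 has_vector_derivative - (1/2) *\<^sub>R bracket_adjoint L (q2 t) (h t)) (at t within {0..1})"
    and q2': "(q2 has_vector_derivative 0) (at t within {0..1})"
    if "t \<in> {0..1}" for t
    using fs(1)[OF fs(1)[OF c'[OF that]]] fs(2)[OF fs(1)[OF c'[OF that]]]
      fs(1)[OF fs(2)[OF c'[OF that]]] fs(2)[OF fs(2)[OF c'[OF that]]]
    unfolding Xc x_def[symmetric] z_def[symmetric] q1_def[symmetric] q2_def[symmetric] by simp_all
  have init: "x 0 = 0" "z 0 = 0" "q1 0 = u" "q2 0 = v"
    by (simp_all add: x_def z_def q1_def q2_def c0)
  have q2: "q2 t = v" if "t \<in> {0..1}" for t
    using constant_of_zero_vector_derivative[OF q2' that] init by simp
  have h: "h t = u" if t: "t \<in> {0..1}" for t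
  proof -
    \<comment> \<open>This is h - u with \<open>q2 t\<close> already replaced by its constant value
      \<open>v\<close>; the two agree on the unit interval.\<close>
    define g where "g t = q1 t - (1/2) *\<^sub>R bracket_adjoint L v (x t) - u" for t
    have hg: "h t = g t + u" if "t \<in> {0..1}" for t by (simp add: h_def g_def q2[OF that])
    have g': "(g has_vector_derivative - bracket_adjoint L v (g t)) (at t within {0..1})" if "t \<in> {0..1}" for t
    proof -
      have "(g has_vector_derivative - (1/2) *\<^sub>R bracket_adjoint L (q2 t) (h t)
          - (1/2) *\<^sub>R bracket_adjoint L v (h t) - 0) (at t within {0..1})"
        unfolding g_def
        by (intro has_vector_derivative_diff has_vector_derivative_const q1'[OF that]
            bounded_linear.has_vector_derivative[OF bounded_linear_scaleR_right]
            K.has_vector_derivative x'[OF that])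
      \<comment> \<open>One half comes from the motion of the covector and one from the motion of
        \<open>x\<close>; together they give the full operator, which kills
        \<open>u\<close>.\<close>
      also have "- (1/2) *\<^sub>R bracket_adjoint L (q2 t) (h t) - (1/2) *\<^sub>R bracket_adjoint L v (h t) - 0
          = - bracket_adjoint L v (g t)"
        unfolding q2[OF that] hg[OF that] K.add Ku
        by (simp only: scaleR_diff_left[symmetric]) simp
      finally show ?thesis .
    qed
    have orth: "g t \<bullet> bracket_adjoint L v (g t) = 0" for t
      using arg_cong[OF skew[of "g t" "g t"], of "(\<bullet>) v"] by (simp add: inner_bracket_form[symmetric])
    have "g t \<bullet> g t = g 0 \<bullet> g 0"
    proof (rule constant_of_zero_vector_derivative[OF _ t])
      fix t :: real assume "t \<in> {0..1}"
      from bounded_bilinear.has_vector_derivative[OF bounded_bilinear_inner g'[OF this] g'[OF this]]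
      show "((\<lambda>t. g t \<bullet> g t) has_vector_derivative 0) (at t within {0..1})"
        by (simp add: orth inner_commute)
    qed
    also have "g 0 = 0" by (simp add: g_def init K.zero)
    finally show ?thesis using hg[OF t] by simp
  qed
  have x: "x t = t *\<^sub>R u" if t: "t \<in> {0..1}" for t
  proof -
    have "x t - t *\<^sub>R u = x 0 - 0 *\<^sub>R u"
      by (rule constant_of_zero_vector_derivative[of 0 1 "\<lambda>t. x t - t *\<^sub>R u", OF _ t])
        (auto intro!: derivative_eq_intros x' simp: h)
    then show ?thesis by (simp add: init)
  qed
  have "z 1 = z 0"
  proof (rule constant_of_zero_vector_derivative[of 0 1])
    fix t :: real assume t: "t \<in> {0..1}"
    show "(z has_vector_derivative 0) (at t within {0..1})"
      using z'[OF t] by (simp add: h[OF t] kernel_left[OF Mu])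
  qed simp
  then show "p = (u, 0)"
    using x[of 1] p by (simp add: x_def z_def init[unfolded z_def] prod_eq_iff c0)
qed

lemma normal_geodesic_kernel: "M *v u = 0 \<Longrightarrow> normal_geodesic L (u, v) t = (t *\<^sub>R u, 0)"
  using exp_e_kernel[of "t *\<^sub>R u" "t *\<^sub>R v"]
  by (simp add: normal_geodesic_def matrix_vector_mult_scaleR)

end

section \<open>Minimizing curves\<close>

text \<open>Variance identity, with \<open>c\<close> the mean of \<open>w\<close>. Its nonnegativity
  shows that constant controls minimize; its vanishing is the equality case.\<close>

lemma has_integral_norm_diff_square:
  fixes w :: "real \<Rightarrow> real^'k::finite"
  assumes w: "ess_bounded a b w" and "a \<le> b" and c: "integral {a..b} w = (b - a) *\<^sub>R c"
  shows "((\<lambda>t. (norm (w t - c))\<^sup>2) has_integral 2 * energy a b w - (b - a) * (norm c)\<^sup>2) {a..b}"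
proof -
  have "((\<lambda>t. w t \<bullet> w t) has_integral 2 * energy a b w) {a..b}"
    using ess_bounded_integrable[OF ess_bounded_bilinear[OF bounded_bilinear_inner w w]]
    by (simp add: energy_def dot_square_norm integrable_integral)
  moreover have "((\<lambda>t. w t \<bullet> c) has_integral (b - a) * (c \<bullet> c)) {a..b}"
    using has_integral_linear[OF integrable_integral[OF ess_bounded_integrable[OF w]] bounded_linear_inner_left, of c]
    by (simp add: o_def c)
  moreover have "((\<lambda>t. c \<bullet> c) has_integral (b - a) * (c \<bullet> c)) {a..b}"
    using has_integral_const_real[of "c \<bullet> c" a b] \<open>a \<le> b\<close> by simp
  ultimately have "((\<lambda>t. w t \<bullet> w t - 2 * (w t \<bullet> c) + c \<bullet> c) has_integral
      2 * energy a b w - 2 * ((b - a) * (c \<bullet> c)) + (b - a) * (c \<bullet> c)) {a..b}"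
    by (intro has_integral_add has_integral_diff has_integral_mult_right)
  then show ?thesis
    by (simp add: power2_norm_eq_inner inner_diff_left inner_diff_right inner_commute algebra_simps)
qed

lemma energy_const: "a \<le> b \<Longrightarrow> energy a b (\<lambda>_. c) = (b - a) * (norm c)\<^sup>2 / 2"
  by (simp add: energy_def)

lemma energy_const_le:
  assumes "ess_bounded a b w" "a \<le> b" "integral {a..b} w = (b - a) *\<^sub>R c"
  shows "energy a b (\<lambda>_. c) \<le> energy a b w"
  using has_integral_nonneg[OF has_integral_norm_diff_square[OF assms]] \<open>a \<le> b\<close>
  by (simp add: energy_const)

text \<open>Equality case: |w - c|^2 has integral zero. To pass to w - c itself, its norm n is
  bounded by r + n^2 / r for arbitrarily small positive r.\<close>

lemma energy_le_const_imp:
  assumes w: "ess_bounded a b w" and "a \<le> b" and c: "integral {a..b} w = (b - a) *\<^sub>R c"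
    and le: "energy a b w \<le> energy a b (\<lambda>_. c)" and t: "t \<in> {a..b}"
  shows "integral {a..t} w = (t - a) *\<^sub>R c"
proof -
  have sub: "f integrable_on {a..b} \<Longrightarrow> f integrable_on {a..t}" for f :: "real \<Rightarrow> 'x::banach"
    by (erule integrable_on_subinterval) (use t in auto)
  note sq = has_integral_norm_diff_square[OF w \<open>a \<le> b\<close> c]
  have sqi: "(\<lambda>t. (norm (w t - c))\<^sup>2) integrable_on {a..t}"
    using sub[OF has_integral_integrable[OF sq]] .
  have zero: "integral {a..t} (\<lambda>t. (norm (w t - c))\<^sup>2) \<le> 0"
  proof -
    have "integral {a..t} (\<lambda>t. (norm (w t - c))\<^sup>2) \<le> integral {a..b} (\<lambda>t. (norm (w t - c))\<^sup>2)"
      using t by (intro integral_subset_le sqi has_integral_integrable[OF sq]) auto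
    then show ?thesis
      using le \<open>a \<le> b\<close> unfolding integral_unique[OF sq] by (simp add: energy_const)
  qed
  have wi: "w integrable_on {a..t}" using sub[OF ess_bounded_integrable[OF w]] .
  have "norm (integral {a..t} (\<lambda>t. w t - c)) \<le> 0 + \<epsilon>" if "\<epsilon> > 0" for \<epsilon>
  proof -
    \<comment> \<open>Solves \<open>r * (t - a + 1) = \<epsilon>\<close>; the \<open>+ 1\<close>
      covers \<open>t = a\<close>.\<close>
    define r where "r = \<epsilon> / (t - a + 1)"
    have r: "r > 0" using \<open>\<epsilon> > 0\<close> t by (simp add: r_def)
    have "norm (integral {a..t} (\<lambda>t. w t - c)) \<le> integral {a..t} (\<lambda>t. r + (norm (w t - c))\<^sup>2 / r)"
    proof (rule integral_norm_bound_integral)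
      show "norm (w s - c) \<le> r + (norm (w s - c))\<^sup>2 / r" for s
      proof -
        have "norm (w s - c) * r \<le> r * r + (norm (w s - c))\<^sup>2"
        proof -
          have "r * r + n\<^sup>2 - n * r = (r - n)\<^sup>2 + r * n" for n :: real
            by (simp add: power2_eq_square algebra_simps)
          then have "0 \<le> r * r + (norm (w s - c))\<^sup>2 - norm (w s - c) * r" using r by simp
          then show ?thesis by simp
        qed
        then show ?thesis using r by (simp add: field_simps power2_eq_square)
      qed
    qed (auto intro!: integrable_diff integrable_add integrable_on_divide wi sqi integrable_const_ivl)
    also have "\<dots> = r * (t - a) + integral {a..t} (\<lambda>t. (norm (w t - c))\<^sup>2) / r"
      using t by (subst integral_add) (auto intro!: integrable_on_divide sqi)
    also have "\<dots> \<le> r * (t - a)" using zero r by (simp add: divide_nonpos_pos)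
    also have "\<dots> \<le> r * (t - a + 1)" using r by simp
    also have "\<dots> = \<epsilon>" using t by (simp add: r_def)
    finally show ?thesis by simp
  qed
  then have "norm (integral {a..t} (\<lambda>t. w t - c)) \<le> 0" by (rule field_le_epsilon)
  then have "integral {a..t} (\<lambda>t. w t - c) = 0" by simp
  then show ?thesis using wi t by (subst (asm) integral_diff) auto
qed

text \<open>The derivative is locally constant, hence constant on the connected interval.\<close>

lemma locally_affine_imp_linear:
  fixes x :: "real \<Rightarrow> 'a::real_normed_vector"
  assumes aff: "\<And>t. t \<in> {0..1} \<Longrightarrow>
      \<exists>\<delta>>0. \<exists>p c. \<forall>s\<in>{0..1}. dist s t < \<delta> \<longrightarrow> x s = p + s *\<^sub>R c"
    and "x 0 = 0"
  shows "\<exists>c. \<forall>t\<in>{0..1}. x t = t *\<^sub>R c"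
proof -
  define D where "D t = vector_derivative x (at t within {0..1})" for t
  have *: "\<exists>\<delta>>0. \<exists>c. \<forall>s\<in>{0..1}. dist s t < \<delta> \<longrightarrow> (x has_vector_derivative c) (at s within {0..1})"
    if t: "t \<in> {0..1}" for t
  proof -
    obtain \<delta> p c where \<delta>: "\<delta> > 0" "\<And>s. s \<in> {0..1} \<Longrightarrow> dist s t < \<delta> \<Longrightarrow> x s = p + s *\<^sub>R c"
      using aff[OF t] by blast
    have "(x has_vector_derivative c) (at s within {0..1})" if s: "s \<in> {0..1}" "dist s t < \<delta>" for s
    proof (rule has_vector_derivative_transform_within)
      show "((\<lambda>s. p + s *\<^sub>R c) has_vector_derivative c) (at s within {0..1})"
        by (auto intro!: derivative_eq_intros)
      \<comment> \<open>By the triangle inequality a ball of this radius around \<open>s\<close>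
        stays where \<open>x\<close> is affine.\<close>
      show "0 < \<delta> - dist s t" using s by simp
      show "p + r *\<^sub>R c = x r" if "r \<in> {0..1}" "dist r s < \<delta> - dist s t" for r
        using \<delta>(2)[OF that(1)] that(2) dist_triangle[of r t s] by simp
    qed fact
    then show ?thesis using \<delta>(1) by blast
  qed
  have Deq: "D s = c" if "(x has_vector_derivative c) (at s within {0..1})" "s \<in> {0..1}" for s c
    using vector_derivative_within_cbox[of 0 1 s x c] that by (simp add: D_def)
  have const: "D t = D 0" if "t \<in> {0..1}" for t
  proof (rule connected_local_const[of "{0..1}"])
    show "\<forall>t\<in>{0..1}. eventually (\<lambda>s. D t = D s) (at t within {0..1})"
    proof
      fix t :: real assume t: "t \<in> {0..1}"
      obtain \<delta> c where \<delta>: "\<delta> > 0"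
        "\<And>s. s \<in> {0..1} \<Longrightarrow> dist s t < \<delta> \<Longrightarrow> (x has_vector_derivative c) (at s within {0..1})"
        using *[OF t] by blast
      then have "D s = c" if "s \<in> {0..1}" "dist s t < \<delta>" for s using Deq that by blast
      then show "eventually (\<lambda>s. D t = D s) (at t within {0..1})"
        unfolding eventually_at using \<delta>(1) t by (intro exI[of _ \<delta>]) auto
    qed
  qed (use that in auto)
  have der: "(x has_vector_derivative D 0) (at t within {0..1})" if t: "t \<in> {0..1}" for t
  proof -
    obtain \<delta> c where "\<delta> > 0"
      "\<And>s. s \<in> {0..1} \<Longrightarrow> dist s t < \<delta> \<Longrightarrow> (x has_vector_derivative c) (at s within {0..1})"
      using *[OF t] by blast
    then have c: "(x has_vector_derivative c) (at t within {0..1})" using t by simp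
    from Deq[OF this t] c const[OF t] show ?thesis by simp
  qed
  have "x t - t *\<^sub>R D 0 = x 0 - 0 *\<^sub>R D 0" if t: "t \<in> {0..1}" for t
    by (rule constant_of_zero_vector_derivative[of 0 1 "\<lambda>t. x t - t *\<^sub>R D 0", OF _ t])
      (auto intro!: derivative_eq_intros der)
  then show ?thesis using \<open>x 0 = 0\<close> by auto
qed

section \<open>Kernel lines and abnormal geodesics\<close>

context kernel_form begin

lemma horizontal_kernel_line:
  assumes Mc: "M *v c = 0" and \<gamma>: "\<And>t. t \<in> {a..b} \<Longrightarrow> \<gamma> t = (p + t *\<^sub>R c, r)" and "a \<le> b"
  shows "horizontal_curve L a b (\<lambda>_. c) \<gamma>"
  unfolding horizontal_curve_iff_integral[OF \<open>a \<le> b\<close>]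
proof (intro conjI ballI)
  show "ess_bounded a b (\<lambda>_. c)" by (rule continuous_on_imp_ess_bounded) simp
  fix t assume "t \<in> {a..b}"
  then show "\<gamma> t = \<gamma> a + (integral {a..t} (\<lambda>_. c), - (1/2) *\<^sub>R integral {a..t} (\<lambda>s. bracket_form L c (fst (\<gamma> s))))"
    using \<open>a \<le> b\<close> by (simp add: \<gamma> kernel_left[OF Mc] algebra_simps)
qed

text \<open>Matching the first components at the endpoints already forces the control of a
  competitor to have mean \<open>c\<close>, so \<open>energy_const_le\<close> applies.\<close>

lemma kernel_line_minimizing:
  assumes Mc: "M *v c = 0" and \<gamma>: "\<And>t. t \<in> {a..b} \<Longrightarrow> \<gamma> t = (p + t *\<^sub>R c, r)" and "a \<le> b"
  shows "energy_minimizing L a b (\<lambda>_. c) \<gamma>"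
  unfolding energy_minimizing_def
proof (intro conjI allI impI)
  show "horizontal_curve L a b (\<lambda>_. c) \<gamma>" by (rule horizontal_kernel_line[OF assms])
  fix w \<eta> assume *: "horizontal_curve L a b w \<eta> \<and> \<eta> a = \<gamma> a \<and> \<eta> b = \<gamma> b"
  then have w: "ess_bounded a b w" by (simp add: horizontal_curve_def Linf_iff_ess_bounded)
  have "\<eta> b = \<eta> a + (integral {a..b} w,
        - (1/2) *\<^sub>R integral {a..b} (\<lambda>s. bracket_form L (w s) (fst (\<eta> s))))"
    using iffD1[OF horizontal_curve_iff_integral[OF \<open>a \<le> b\<close>] conjunct1[OF *]] \<open>a \<le> b\<close>
    by (meson atLeastAtMost_iff order_refl)
  from arg_cong[OF this, of fst] have "fst (\<eta> b) = fst (\<eta> a) + integral {a..b} w" by simp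
  then have "integral {a..b} w = (b - a) *\<^sub>R c"
    using * \<open>a \<le> b\<close> by (simp add: \<gamma> algebra_simps)
  then show "energy a b (\<lambda>_. c) \<le> energy a b w" using energy_const_le[OF w \<open>a \<le> b\<close>] by blast
qed

lemma kernel_line_geodesic:
  assumes Mu: "M *v u = 0" and \<gamma>: "\<And>t. t \<in> {0..1} \<Longrightarrow> \<gamma> t = (t *\<^sub>R u, 0)"
  shows "geodesic L \<gamma>" "abnormal_curve L \<gamma>"
proof -
  have line: "\<gamma> t = (0 + t *\<^sub>R u, 0)" if "t \<in> {0..1}" for t using \<gamma>[OF that] by simp
  have hor: "horizontal_curve L 0 1 (\<lambda>_. u) \<gamma>" by (rule horizontal_kernel_line[OF Mu line]) auto
  have "energy_minimizing L a b (\<lambda>_. u) \<gamma>" if "a < b" "{a..b} \<subseteq> {0..1}" for a b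
    by (rule kernel_line_minimizing[OF Mu line]) (use that in auto)
  then show "geodesic L \<gamma>"
    unfolding geodesic_def using hor by (intro exI[of _ "\<lambda>_. u"]) (auto intro!: exI[of _ 1])
  show "abnormal_curve L \<gamma>"
    unfolding abnormal_curve_iff using hor Mu \<gamma>[of 0]
    by (intro exI[of _ "\<lambda>_. u"]) (auto simp: zero_prod_def)
qed

text \<open>Abnormality keeps the curve in the kernel, where all brackets vanish and the second
  component stays 0. There each short minimizing arc equals its chord, and overlapping arcs fit into
  a single line.\<close>

lemma abnormal_geodesic_imp_kernel_line:
  assumes geo: "geodesic L \<gamma>" and abn: "abnormal_curve L \<gamma>"
  shows "\<exists>c. M *v c = 0 \<and> (\<forall>t\<in>{0..1}. \<gamma> t = (t *\<^sub>R c, 0))"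
proof -
  obtain u where hor: "horizontal_curve L 0 1 u \<gamma>" and \<gamma>0: "\<gamma> 0 = 0"
    and ker: "AE t in lebesgue_on {0..1}. M *v u t = 0"
    using abn unfolding abnormal_curve_iff by blast
  then have u: "ess_bounded 0 1 u" by (simp add: horizontal_curve_def Linf_iff_ess_bounded)
  have \<gamma>: "\<gamma> t = (integral {0..t} u,
        - (1/2) *\<^sub>R integral {0..t} (\<lambda>s. bracket_form L (u s) (fst (\<gamma> s))))" if "t \<in> {0..1}" for t
  proof -
    have "\<gamma> t = \<gamma> 0 + (integral {0..t} u,
        - (1/2) *\<^sub>R integral {0..t} (\<lambda>s. bracket_form L (u s) (fst (\<gamma> s))))"
      using iffD1[OF horizontal_curve_iff_integral[OF zero_le_one] hor] that by blast
    then show ?thesis by (simp only: \<gamma>0 add_0)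
  qed
  have Mx: "M *v fst (\<gamma> t) = 0" if "t \<in> {0..1}" for t
    by (subst \<gamma>[OF that]) (simp add: integral_in_kernel[OF u ker that])
  have z: "snd (\<gamma> t) = 0" if t: "t \<in> {0..1}" for t
  proof -
    have "integral {0..t} (\<lambda>s. bracket_form L (u s) (fst (\<gamma> s))) = integral {0..t} (\<lambda>s. 0)"
      using t by (intro integral_cong kernel Mx) auto
    then show ?thesis by (subst \<gamma>[OF t]) simp
  qed
  \<comment> \<open>Minimality comes with its own control; it is related to \<open>u\<close> only
    through the common curve.\<close>
  obtain u' where "horizontal_curve L 0 1 u' \<gamma>" and
    min: "\<And>t. t \<in> {0..1} \<Longrightarrow> \<exists>\<delta>>0. \<forall>a b. a < b \<and> {a..b} \<subseteq> {0..1} \<inter> {t - \<delta>..t + \<delta>} \<longrightarrow>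
          energy_minimizing L a b u' \<gamma>"
    using geo unfolding geodesic_def by blast
  have affine: "fst (\<gamma> t) = p + t *\<^sub>R c"
    if "a < b" "{a..b} \<subseteq> {0..1}" "energy_minimizing L a b u' \<gamma>"
      and c: "c = (1 / (b - a)) *\<^sub>R (fst (\<gamma> b) - fst (\<gamma> a))" and p: "p = fst (\<gamma> a) - a *\<^sub>R c"
      and t: "t \<in> {a..b}" for a b c p t
  proof -
    have ab: "a \<in> {0..1}" "b \<in> {0..1}" "a \<le> b" using that(1,2) by auto
    have hor': "horizontal_curve L a b u' \<gamma>" using that(3) by (simp add: energy_minimizing_def)
    then have u': "ess_bounded a b u'" by (simp add: horizontal_curve_def Linf_iff_ess_bounded)
    have x: "fst (\<gamma> t) = fst (\<gamma> a) + integral {a..t} u'" if "t \<in> {a..b}" for t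
    proof -
      have "\<gamma> t = \<gamma> a + (integral {a..t} u',
          - (1/2) *\<^sub>R integral {a..t} (\<lambda>s. bracket_form L (u' s) (fst (\<gamma> s))))"
        using iffD1[OF horizontal_curve_iff_integral[OF ab(3)] hor'] that by blast
      from arg_cong[OF this, of fst] show ?thesis by simp
    qed
    have cab: "(b - a) *\<^sub>R c = fst (\<gamma> b) - fst (\<gamma> a)" using \<open>a < b\<close> by (simp add: c)
    have I: "integral {a..b} u' = (b - a) *\<^sub>R c" using x[of b] ab by (simp add: cab)
    \<comment> \<open>Both ends of the chord lie in the kernel, hence so does its direction.\<close>
    have Mc: "M *v c = 0"
      by (simp add: c matrix_vector_mult_scaleR matrix_vector_mult_diff_distrib Mx[OF ab(1)] Mx[OF ab(2)])
    have line: "horizontal_curve L a b (\<lambda>_. c) (\<lambda>t. (p + t *\<^sub>R c, 0))"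
      by (rule horizontal_kernel_line[OF Mc _ ab(3)]) simp
    \<comment> \<open>Chord and arc share both endpoints, so the chord is an admissible
      competitor.\<close>
    have "(p + a *\<^sub>R c, 0) = \<gamma> a" "(p + b *\<^sub>R c, 0) = \<gamma> b"
      using cab z ab by (simp_all add: p prod_eq_iff algebra_simps)
    then have "energy a b u' \<le> energy a b (\<lambda>_. c)"
      using that(3) line unfolding energy_minimizing_def by blast
    from energy_le_const_imp[OF u' ab(3) I this t] x[OF t] show ?thesis
      by (simp add: p algebra_simps)
  qed
  have "\<exists>c. \<forall>t\<in>{0..1}. fst (\<gamma> t) = t *\<^sub>R c"
  proof (rule locally_affine_imp_linear)
    fix t :: real assume t: "t \<in> {0..1}"
    obtain \<delta> where \<delta>: "\<delta> > 0" "\<And>a b. a < b \<Longrightarrow> {a..b} \<subseteq> {0..1} \<inter> {t - \<delta>..t + \<delta>} \<Longrightarrow>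
          energy_minimizing L a b u' \<gamma>"
      using min[OF t] by blast
    \<comment> \<open>The window is clipped to the unit interval; it keeps positive length even at
      \<open>t = 0\<close> and \<open>t = 1\<close>.\<close>
    define a b where "a = max 0 (t - \<delta>)" and "b = min 1 (t + \<delta>)"
    have ab: "a < b" "{a..b} \<subseteq> {0..1}" "{a..b} \<subseteq> {0..1} \<inter> {t - \<delta>..t + \<delta>}"
      using t \<delta>(1) by (auto simp: a_def b_def)
    have "s \<in> {a..b}" if "s \<in> {0..1}" "dist s t < \<delta>" for s
      using that by (auto simp: a_def b_def dist_real_def)
    with affine[OF ab(1,2) \<delta>(2)[OF ab(1,3)] refl refl] \<delta>(1)
    show "\<exists>\<delta>>0. \<exists>p c. \<forall>s\<in>{0..1}. dist s t < \<delta> \<longrightarrow> fst (\<gamma> s) = p + s *\<^sub>R c" by blast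
  qed (simp add: \<gamma>0)
  then obtain c where c: "\<And>t. t \<in> {0..1} \<Longrightarrow> fst (\<gamma> t) = t *\<^sub>R c" by blast
  have "M *v c = 0" using Mx[of 1] c[of 1] by simp
  moreover have "\<gamma> t = (t *\<^sub>R c, 0)" if "t \<in> {0..1}" for t
    using c[OF that] z[OF that] by (simp add: prod_eq_iff)
  ultimately show ?thesis by blast
qed

lemma abnormal_geodesic_iff:
  "geodesic L \<gamma> \<and> abnormal_curve L \<gamma> \<longleftrightarrow>
    (\<exists>u v. M *v u = 0 \<and> (\<forall>t\<in>{0..1}. \<gamma> t = normal_geodesic L (u, v) t))"
proof
  assume "geodesic L \<gamma> \<and> abnormal_curve L \<gamma>"
  then show "\<exists>u v. M *v u = 0 \<and> (\<forall>t\<in>{0..1}. \<gamma> t = normal_geodesic L (u, v) t)"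
    using abnormal_geodesic_imp_kernel_line by (auto simp: normal_geodesic_kernel cong: conj_cong)
next
  assume "\<exists>u v. M *v u = 0 \<and> (\<forall>t\<in>{0..1}. \<gamma> t = normal_geodesic L (u, v) t)"
  then show "geodesic L \<gamma> \<and> abnormal_curve L \<gamma>"
    using kernel_line_geodesic by (auto simp: normal_geodesic_kernel)
qed

end

theorem lemma18:
  fixes br :: "'g::euclidean_space \<Rightarrow> 'g \<Rightarrow> 'g" and g1 g2 :: "'g set" and S :: "'g \<Rightarrow> 'g"
    and e :: "'k::finite \<Rightarrow> 'g" and f :: "'m::finite \<Rightarrow> 'g"
    and L :: "'m \<Rightarrow> 'k \<Rightarrow> 'k \<Rightarrow> real" and M :: "real^'k^'k"
  assumes "generalized_H_type br g1 g2 S"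
    and "orthonormal_basis e g1" and "orthonormal_basis f g2"
    and "\<forall>i. \<exists>s. S (e i) = s *\<^sub>R e i"
    and L: "L = structure_constants br e f"
    and M: "M = operator_matrix e S"
  shows
    "(\<forall>\<gamma>. abnormal_curve L \<gamma> \<longleftrightarrow>
        (\<exists>u. horizontal_curve L 0 1 u \<gamma> \<and> \<gamma> 0 = 0 \<and>
             (AE t in lebesgue_on {0..1}. M *v u t = 0))) \<and>
     (\<forall>\<gamma>. geodesic L \<gamma> \<and> abnormal_curve L \<gamma> \<longleftrightarrow>
        (\<exists>u v. M *v u = 0 \<and> (\<forall>t\<in>{0..1}. \<gamma> t = normal_geodesic L (u, v) t))) \<and>
     (\<forall>u v. M *v u = 0 \<longrightarrow>
        (\<forall>t\<in>{0..1}. exp_e L (t *\<^sub>R u, t *\<^sub>R v) = (t *\<^sub>R u, 0)))"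
proof -
  interpret kernel_form L M
    unfolding L M by (rule generalized_H_type_kernel_form[OF assms(1-3)])
  show ?thesis
    using abnormal_curve_iff abnormal_geodesic_iff exp_e_kernel
    by (auto simp: matrix_vector_mult_scaleR)
qed

end
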